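(* Any algorithm in the LOCAL model with shared randomness that solves the $\varepsilon$-almost-spanning forest problem with high probability takes at least $\Omega\left(\frac1\varepsilon\right)$ rounds.
   Context: LOCAL model with shared randomness: given a graph $G$, each vertex hosts a machine with unbounded memory and computation that initially knows its adjacency list; computation proceeds in synchronous rounds of arbitrary local computation followed by sending a message of arbitrary length to each neighbor; all machines have access to a common infinite random tape; at the end each vertex outputs its part of the output (here, for each incident edge, whether it is removed; adjacent vertices must agree). The $\varepsilon$-almost-spanning forest problem: given $0<\varepsilon<1$ and a graph $G$ on $n$ vertices each of whose connected components is a cycle or a path, with $c$ the number of cycles, remove a set of edges such that (1) at least one edge of each cycle is removed and (2) at most $c+\varepsilon n$ edges are removed in total. *)

theory Defs
  imports "HOL-Probability.Probability" "HOL-Library.Landau_Symbols"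
begin

section \<open>Graphs whose components are cycles and paths\<close>

text \<open>
  A simple graph on \<open>n\<close> vertices has vertex set \<open>{..<n}\<close> and is given by its set of edges,
  which are two-element sets of vertices. Vertices double as the identifiers of the machines,
  so algorithms are only asked to cope with the smallest possible identifier space.
\<close>

definition simple_graph :: "nat \<Rightarrow> nat set set \<Rightarrow> bool" where
  "simple_graph n E \<longleftrightarrow> E \<subseteq> {{u, v} |u v. u < n \<and> v < n \<and> u \<noteq> v}"

definition neighbours :: "nat set set \<Rightarrow> nat \<Rightarrow> nat set" where
  "neighbours E v = {u. {v, u} \<in> E}"

definition components :: "nat \<Rightarrow> nat set set \<Rightarrow> nat set set" where
  "components n E = {..<n} // {(u, v). {u, v} \<in> E}\<^sup>*"

definition edges_within :: "nat set set \<Rightarrow> nat set \<Rightarrow> nat set set" where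
  "edges_within E C = {e \<in> E. e \<subseteq> C}"

definition is_path :: "nat set set \<Rightarrow> nat set \<Rightarrow> bool" where
  "is_path E C \<longleftrightarrow> (\<exists>vs. distinct vs \<and> vs \<noteq> [] \<and> set vs = C \<and>
     edges_within E C = {{vs ! i, vs ! Suc i} |i. Suc i < length vs})"

definition is_cycle :: "nat set set \<Rightarrow> nat set \<Rightarrow> bool" where
  "is_cycle E C \<longleftrightarrow> (\<exists>vs. distinct vs \<and> length vs \<ge> 3 \<and> set vs = C \<and>
     edges_within E C = {{vs ! i, vs ! (Suc i mod length vs)} |i. i < length vs})"

definition cycles_and_paths :: "nat \<Rightarrow> nat set set \<Rightarrow> bool" where
  "cycles_and_paths n E \<longleftrightarrow>
     simple_graph n E \<and> (\<forall>C \<in> components n E. is_cycle E C \<or> is_path E C)"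

definition cycles :: "nat \<Rightarrow> nat set set \<Rightarrow> nat set set" where
  "cycles n E = {C \<in> components n E. is_cycle E C}"


section \<open>Almost-spanning forests\<close>

definition almost_spanning_forest :: "real \<Rightarrow> nat \<Rightarrow> nat set set \<Rightarrow> nat set set \<Rightarrow> bool" where
  "almost_spanning_forest \<epsilon> n E R \<longleftrightarrow>
     R \<subseteq> E \<and>
     (\<forall>C \<in> cycles n E. R \<inter> edges_within E C \<noteq> {}) \<and>
     real (card R) \<le> real (card (cycles n E)) + \<epsilon> * real n"


section \<open>The LOCAL model with shared randomness\<close>

text \<open>
  Memory contents and messages are bit strings of unbounded length. Since local computation is
  unrestricted, it is modelled by arbitrary functions; each has access to the common random tape.
  An algorithm may depend on the number of vertices and on \<open>\<epsilon>\<close>, as these are fixed before it.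
\<close>

type_synonym tape = "nat \<Rightarrow> bool"
type_synonym memory = "bool list"
type_synonym message = "bool list"

text \<open>
  \<open>alg_init\<close> receives the identifier of the vertex and its adjacency list, \<open>alg_send\<close> the
  neighbour to which the message goes, \<open>alg_receive\<close> the incoming messages indexed by sender
  (\<open>None\<close> for non-neighbours), and \<open>alg_output\<close> tells whether the edge to the given neighbour
  is removed.
\<close>

record local_algorithm =
  alg_init :: "tape \<Rightarrow> nat \<Rightarrow> nat set \<Rightarrow> memory"
  alg_send :: "tape \<Rightarrow> memory \<Rightarrow> nat \<Rightarrow> message"
  alg_receive :: "tape \<Rightarrow> memory \<Rightarrow> (nat \<rightharpoonup> message) \<Rightarrow> memory"
  alg_output :: "tape \<Rightarrow> memory \<Rightarrow> nat \<Rightarrow> bool"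

primrec memory_after ::
    "local_algorithm \<Rightarrow> nat set set \<Rightarrow> tape \<Rightarrow> nat \<Rightarrow> nat \<Rightarrow> memory" where
  "memory_after A E \<omega> 0 v = alg_init A \<omega> v (neighbours E v)"
| "memory_after A E \<omega> (Suc t) v =
     alg_receive A \<omega> (memory_after A E \<omega> t v)
       (\<lambda>u. if u \<in> neighbours E v then Some (alg_send A \<omega> (memory_after A E \<omega> t u) v) else None)"

definition removes ::
    "local_algorithm \<Rightarrow> nat set set \<Rightarrow> tape \<Rightarrow> nat \<Rightarrow> nat \<Rightarrow> nat \<Rightarrow> bool" where
  "removes A E \<omega> T v u \<longleftrightarrow> alg_output A \<omega> (memory_after A E \<omega> T v) u"

definition successful_run ::
    "real \<Rightarrow> nat \<Rightarrow> nat \<Rightarrow> local_algorithm \<Rightarrow> nat set set \<Rightarrow> tape \<Rightarrow> bool" where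
  "successful_run \<epsilon> n T A E \<omega> \<longleftrightarrow>
     (\<forall>u v. {u, v} \<in> E \<longrightarrow> removes A E \<omega> T u v = removes A E \<omega> T v u) \<and>
     almost_spanning_forest \<epsilon> n E {{u, v} |u v. {u, v} \<in> E \<and> removes A E \<omega> T u v}"

definition random_tape :: "tape measure" where
  "random_tape = PiM UNIV (\<lambda>_. measure_pmf (bernoulli_pmf (1 / 2)))"

text \<open>
  ``With high probability'' is the weakest customary requirement: probability at least
  \<open>1 - 1 / n\<close> on every input. For \<open>n \<ge> 2\<close> a set of tapes that is not measurable
  never meets it, since \<^const>\<open>measure\<close> assigns \<open>0\<close> to such sets.
\<close>

definition solves_whp :: "real \<Rightarrow> nat \<Rightarrow> nat \<Rightarrow> local_algorithm \<Rightarrow> bool" where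
  "solves_whp \<epsilon> n T A \<longleftrightarrow>
     (\<forall>E. cycles_and_paths n E \<longrightarrow>
        measure random_tape {\<omega> \<in> space random_tape. successful_run \<epsilon> n T A E \<omega>} \<ge> 1 - 1 / real n)"

text \<open>
  A bound of order \<open>1 / \<epsilon>\<close> on the number of rounds needs \<open>n\<close> to be of at least that order, because
  \<open>n\<close> rounds suffice to inspect a whole component, and it needs \<open>n\<close> to be large in terms of \<open>\<epsilon>\<close>
  when \<open>\<epsilon>\<close> is close to \<open>1\<close>, because all edges may be removed if \<open>\<epsilon> \<ge> 1 - 1 / n\<close>. The bound is
  therefore to be stated for all \<open>n \<ge> N \<epsilon>\<close>, where \<open>N \<epsilon> = O(1 / \<epsilon>)\<close> as \<open>\<epsilon>\<close> tends to \<open>0\<close>.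
\<close>

end

theory Submission
  imports Defs
begin

text \<open>
  If fewer than \<open>n\<close> inputs are fixed in advance, then by the union bound some tape makes the algorithm
  succeed on all of them, so randomness can be removed. The inputs are unions of \<open>n div k\<close> disjoint
  copies of a pattern on \<open>k\<close> vertices.

  For small \<open>\<epsilon>\<close>, let \<open>k = 4 * T + 4\<close>. Compare the cycle on \<open>0, \<dots>, k - 1\<close> with the two paths that arise
  from it by deleting one of two antipodal edges. Every vertex has the same view in the cycle and in
  one of the paths, and every copy of the cycle loses an edge. Hence the two inputs made of paths
  together lose at least \<open>n div k\<close> edges, although they may lose only \<open>2 * \<epsilon> * n\<close>.

  For the other \<open>\<epsilon>\<close> it only has to be shown that \<open>T = 0\<close> is impossible. Then the edges kept on a block
  do not depend on the pattern and contain no cycle of length \<open>4\<close>, so they are few. But of the path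
  systems with edges \<open>{i, i + s}\<close>, a fraction of almost \<open>1 - \<epsilon>\<close> of the edges must be kept for every \<open>s\<close>.
\<close>

section \<open>Components\<close>

lemma simple_graphD:
  assumes "simple_graph n E" "{u, v} \<in> E"
  shows "u < n" "v < n" "u \<noteq> v"
  using assms unfolding simple_graph_def by (auto simp: doubleton_eq_iff)

lemma simple_graph_edgeE:
  assumes "simple_graph n E" "e \<in> E"
  obtains u v where "e = {u, v}" "u < n" "v < n" "u \<noteq> v"
  using assms unfolding simple_graph_def by blast

text \<open>Both shapes contain a spanning path, which is all that connectivity of \<open>C\<close>
  requires; the closing edge of a cycle is dropped.\<close>

lemma is_cycle_or_is_pathE:
  assumes "is_cycle E C \<or> is_path E C"
  obtains vs where "distinct vs" "vs \<noteq> []" "set vs = C"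
    "\<And>i. Suc i < length vs \<Longrightarrow> {vs ! i, vs ! Suc i} \<in> E"
  using assms
proof
  assume "is_cycle E C"
  then obtain vs where vs: "distinct vs" "length vs \<ge> 3" "set vs = C"
    "edges_within E C = {{vs ! i, vs ! (Suc i mod length vs)} |i. i < length vs}"
    unfolding is_cycle_def by auto
  have "{vs ! i, vs ! Suc i} \<in> E" if "Suc i < length vs" for i
  proof -
    have "{vs ! i, vs ! Suc i} = {vs ! i, vs ! (Suc i mod length vs)}" using that by simp
    then have "{vs ! i, vs ! Suc i} \<in> edges_within E C" unfolding vs(4) using Suc_lessD[OF that] by blast
    then show ?thesis unfolding edges_within_def by simp
  qed
  then show thesis using vs that by force
next
  assume "is_path E C"
  then obtain vs where vs: "distinct vs" "vs \<noteq> []" "set vs = C"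
    "edges_within E C = {{vs ! i, vs ! Suc i} |i. Suc i < length vs}"
    unfolding is_path_def by auto
  have "{vs ! i, vs ! Suc i} \<in> E" if "Suc i < length vs" for i
  proof -
    have "{vs ! i, vs ! Suc i} \<in> edges_within E C" unfolding vs(4) using that by blast
    then show ?thesis unfolding edges_within_def by simp
  qed
  then show thesis using vs that by force
qed

text \<open>No edge leaves a block of the partition \<open>P\<close>, so a connectivity class stays
  inside one block. Conversely, the vertex list of a block joins each of its vertices to the first
  one.\<close>

lemma components_eqI:
  assumes E: "simple_graph n E"
    and P: "\<Union>P = {..<n}" "disjoint P" "\<And>e. e \<in> E \<Longrightarrow> \<exists>C\<in>P. e \<subseteq> C"
    and C: "\<And>C. C \<in> P \<Longrightarrow> is_cycle E C \<or> is_path E C"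
  shows "components n E = P"
proof -
  define r where "r = {(u, v). {u, v} \<in> E}"
  have sym_r: "sym (r\<^sup>*)" by (rule sym_rtrancl) (auto simp: sym_def r_def insert_commute)
  have class_eq: "r\<^sup>* `` {u} = D" if D: "D \<in> P" and u: "u \<in> D" for D u
  proof
    have "v \<in> D" if "(u, v) \<in> r\<^sup>*" for v
      using that
    proof induction
      case (step v w)
      then obtain D' where "D' \<in> P" "{v, w} \<subseteq> D'" using P(3) unfolding r_def by blast
      moreover have "D' = D"
        using P(2) calculation step.IH D unfolding disjoint_def by blast
      ultimately show ?case by simp
    qed (use u in simp)
    then show "r\<^sup>* `` {u} \<subseteq> D" by blast
    obtain vs where vs: "distinct vs" "vs \<noteq> []" "set vs = D"
      "\<And>i. Suc i < length vs \<Longrightarrow> {vs ! i, vs ! Suc i} \<in> E"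
      using is_cycle_or_is_pathE[OF C[OF D]] by metis
    have reach: "i < length vs \<Longrightarrow> (vs ! 0, vs ! i) \<in> r\<^sup>*" for i
    proof (induction i)
      case (Suc i)
      then have "(vs ! i, vs ! Suc i) \<in> r" using vs(4) unfolding r_def by simp
      then show ?case using Suc by (meson Suc_lessD rtrancl.rtrancl_into_rtrancl)
    qed simp
    have "(vs ! 0, v) \<in> r\<^sup>*" if "v \<in> D" for v
      using that reach unfolding vs(3)[symmetric] in_set_conv_nth by auto
    then show "D \<subseteq> r\<^sup>* `` {u}"
      using u sym_r by (meson Image_singleton_iff rtrancl_trans subsetI symD)
  qed
  have ne: "\<exists>u. u \<in> D" if "D \<in> P" for D
    using is_cycle_or_is_pathE[OF C[OF that]] by (metis last_in_set)
  show ?thesis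
    unfolding components_def r_def[symmetric]
  proof (intro equalityI subsetI)
    fix D assume "D \<in> {..<n} // r\<^sup>*"
    then obtain u where "u < n" "D = r\<^sup>* `` {u}" unfolding quotient_def by auto
    then show "D \<in> P" using P(1) class_eq by (metis UnionE lessThan_iff)
  next
    fix D assume D: "D \<in> P"
    then obtain u where u: "u \<in> D" using ne by blast
    then have "u < n" using D P(1) by auto
    then show "D \<in> {..<n} // r\<^sup>*" using class_eq[OF D u] by (metis lessThan_iff quotientI)
  qed
qed

lemma cycles_and_pathsI:
  assumes "simple_graph n E" "\<Union>P = {..<n}" "disjoint P" "\<And>e. e \<in> E \<Longrightarrow> \<exists>C\<in>P. e \<subseteq> C"
    and "\<And>C. C \<in> P \<Longrightarrow> is_cycle E C \<or> is_path E C"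
  shows "cycles_and_paths n E" "cycles n E = {C \<in> P. is_cycle E C}"
  using assms components_eqI[OF assms] unfolding cycles_and_paths_def cycles_def by auto

text \<open>Both lists would have the same length \<open>l\<close>, but a cycle has \<open>l\<close>
  different edges and a path at most \<open>l - 1\<close>.\<close>

lemma is_path_imp_not_is_cycle:
  assumes "is_path E C"
  shows "\<not> is_cycle E C"
proof
  assume "is_cycle E C"
  then obtain ws where ws: "distinct ws" "length ws \<ge> 3" "set ws = C"
    "edges_within E C = {{ws ! i, ws ! (Suc i mod length ws)} |i. i < length ws}"
    unfolding is_cycle_def by auto
  obtain vs where vs: "distinct vs" "vs \<noteq> []" "set vs = C"
    "edges_within E C = {{vs ! i, vs ! Suc i} |i. Suc i < length vs}"
    using assms unfolding is_path_def by auto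
  let ?l = "length ws"
  have l: "length vs = ?l" using vs(1,3) ws(1,3) distinct_card by metis
  have "inj_on (\<lambda>i. {ws ! i, ws ! (Suc i mod ?l)}) {..<?l}"
  proof (rule inj_onI)
    fix i j assume ij: "i \<in> {..<?l}" "j \<in> {..<?l}"
      and eq: "{ws ! i, ws ! (Suc i mod ?l)} = {ws ! j, ws ! (Suc j mod ?l)}"
    have "?l > 0" using ws(2) by linarith
    then have b: "Suc i mod ?l < ?l" "Suc j mod ?l < ?l" by (rule mod_less_divisor)+
    show "i = j"
    proof (rule ccontr)
      assume "i \<noteq> j"
      then have "ws ! i \<noteq> ws ! j" using ij ws(1) by (simp add: nth_eq_iff_index_eq)
      then have "ws ! i = ws ! (Suc j mod ?l)" "ws ! (Suc i mod ?l) = ws ! j"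
        using eq by (auto simp: doubleton_eq_iff)
      then have "i = Suc j mod ?l" "Suc i mod ?l = j"
        using ij ws(1) b by (simp_all add: nth_eq_iff_index_eq)
      \<comment> \<open>Edges at different positions could only coincide when reversed. Then
        \<open>i\<close> and \<open>i + 2\<close> would agree modulo the length, which is at least
        3.\<close>
      then show False using ij ws(2) by (auto simp: mod_Suc split: if_splits)
    qed
  qed
  then have "card ((\<lambda>i. {ws ! i, ws ! (Suc i mod ?l)}) ` {..<?l}) = ?l" by (simp add: card_image)
  moreover have "(\<lambda>i. {ws ! i, ws ! (Suc i mod ?l)}) ` {..<?l} = edges_within E C"
    unfolding ws(4) by auto
  moreover have "edges_within E C = (\<lambda>i. {vs ! i, vs ! Suc i}) ` {..<?l - 1}"
    unfolding vs(4) using l by auto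
  moreover have "card ((\<lambda>i. {vs ! i, vs ! Suc i}) ` {..<?l - 1}) \<le> ?l - 1"
    using card_image_le[of "{..<?l - 1}"] by simp
  ultimately show False using ws(2) by simp
qed

lemma is_path_singleton:
  assumes "simple_graph n E"
  shows "is_path E {x}"
proof -
  have "edges_within E {x} = {}"
    using assms unfolding edges_within_def simple_graph_def by auto
  then show ?thesis unfolding is_path_def by (intro exI[of _ "[x]"]) simp
qed

text \<open>Serves patterns in which one component carries all edges: the vertices outside
  \<open>C\<close> are isolated and complete the partition as singletons.\<close>

lemma cycles_and_paths_single:
  assumes E: "simple_graph k E" "\<And>e. e \<in> E \<Longrightarrow> e \<subseteq> C" and C: "C \<subseteq> {..<k}"
    and kind: "is_cycle E C \<or> is_path E C"
  shows "cycles_and_paths k E" "is_cycle E C \<Longrightarrow> C \<in> cycles k E" "is_path E C \<Longrightarrow> cycles k E = {}"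
proof -
  let ?P = "insert C {{x} |x. x < k \<and> x \<notin> C}"
  have U: "\<Union>?P = {..<k}" using C by auto
  have D: "disjoint ?P" unfolding disjoint_def by auto
  have EP: "\<exists>C\<in>?P. e \<subseteq> C" if "e \<in> E" for e using E(2)[OF that] by blast
  have K: "is_cycle E D \<or> is_path E D" if "D \<in> ?P" for D
    using that kind is_path_singleton[OF E(1)] by blast
  note * = cycles_and_pathsI[OF E(1) U D EP K]
  show "cycles_and_paths k E" by (rule *(1))
  have cyc: "cycles k E = {D \<in> ?P. is_cycle E D}" by (rule *(2))
  show "is_cycle E C \<Longrightarrow> C \<in> cycles k E" unfolding cyc by simp
  show "cycles k E = {}" if "is_path E C"
    unfolding cyc using is_path_imp_not_is_cycle[OF that]
      is_path_imp_not_is_cycle[OF is_path_singleton[OF E(1)]] by blast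
qed

section \<open>Disjoint copies of a pattern\<close>

text \<open>Copy \<open>j\<close> occupies the block of \<open>k\<close> vertices starting at
  \<open>j * k\<close>. The vertices from \<open>n div k * k\<close> on stay isolated, so
  \<open>k\<close> need not divide \<open>n\<close>.\<close>

definition copies :: "nat \<Rightarrow> nat \<Rightarrow> nat set set \<Rightarrow> nat set set" where
  "copies n k E = (\<Union>j<n div k. (\<lambda>e. (+) (j * k) ` e) ` E)"

lemma block_eq_iff:
  fixes j i k x y :: nat
  assumes "x < k" "y < k"
  shows "j * k + x = i * k + y \<longleftrightarrow> j = i \<and> x = y"
proof -
  have "(j * k + x) div k = j" "(j * k + x) mod k = x" "(i * k + y) div k = i" "(i * k + y) mod k = y"
    using assms by auto
  then show ?thesis by metis
qed

lemma block_less: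
  fixes j n k x :: nat
  assumes "j < n div k" "x < k"
  shows "j * k + x < n"
proof -
  have "j * k + x < (j + 1) * k" using assms(2) by simp
  also have "\<dots> \<le> n div k * k" using assms(1) by (intro mult_right_mono) auto
  also have "\<dots> \<le> n" by simp
  finally show ?thesis .
qed

lemma simple_graph_copies:
  assumes "simple_graph k E"
  shows "simple_graph n (copies n k E)"
  unfolding simple_graph_def
proof
  fix e assume "e \<in> copies n k E"
  then obtain j e' where je: "j < n div k" "e' \<in> E" "e = (+) (j * k) ` e'" unfolding copies_def by auto
  then obtain u v where "e' = {u, v}" "u < k" "v < k" "u \<noteq> v" using simple_graph_edgeE[OF assms] by metis
  then have "e = {j * k + u, j * k + v}" "j * k + u < n" "j * k + v < n" "j * k + u \<noteq> j * k + v"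
    using je block_less by auto
  then show "e \<in> {{u, v} |u v. u < n \<and> v < n \<and> u \<noteq> v}" by blast
qed

text \<open>As \<open>w\<close> is arbitrary, this also expresses that no edge leaves a
  block.\<close>

lemma pair_in_copies_iff:
  assumes E: "simple_graph k E" and j: "j < n div k" and x: "x < k"
  shows "{j * k + x, w} \<in> copies n k E \<longleftrightarrow> (\<exists>y. w = j * k + y \<and> {x, y} \<in> E)"
proof
  assume "{j * k + x, w} \<in> copies n k E"
  then obtain i e where e: "i < n div k" "e \<in> E" "{j * k + x, w} = (+) (i * k) ` e" unfolding copies_def by auto
  obtain u v where uv: "e = {u, v}" "u < k" "v < k" using simple_graph_edgeE[OF E e(2)] by metis
  have "{j * k + x, w} = {i * k + u, i * k + v}" using e(3) uv by simp
  then consider "j * k + x = i * k + u" "w = i * k + v" | "j * k + x = i * k + v" "w = i * k + u"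
    by (auto simp: doubleton_eq_iff)
  then show "\<exists>y. w = j * k + y \<and> {x, y} \<in> E"
  proof cases
    case 1 then show ?thesis using block_eq_iff[OF x uv(2)] e uv by auto
  next
    case 2
    then have "j = i" "x = v" using block_eq_iff[OF x uv(3)] by auto
    then show ?thesis using 2 e uv by (auto simp: insert_commute)
  qed
next
  assume "\<exists>y. w = j * k + y \<and> {x, y} \<in> E"
  then obtain y where y: "w = j * k + y" "{x, y} \<in> E" by blast
  have "{j * k + x, w} = (+) (j * k) ` {x, y}" using y by simp
  then show "{j * k + x, w} \<in> copies n k E" unfolding copies_def using j y by blast
qed

lemma neighbours_copies:
  assumes "simple_graph k E" "j < n div k" "x < k"
  shows "neighbours (copies n k E) (j * k + x) = (+) (j * k) ` neighbours E x"
  unfolding neighbours_def using pair_in_copies_iff[OF assms] by auto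

lemma edges_within_copies:
  assumes E: "simple_graph k E" and j: "j < n div k" and C: "C \<subseteq> {..<k}"
  shows "edges_within (copies n k E) ((+) (j * k) ` C) = (`) ((+) (j * k)) ` edges_within E C"
proof (intro equalityI subsetI)
  fix e assume e: "e \<in> edges_within (copies n k E) ((+) (j * k) ` C)"
  then obtain u v where uv: "e = {u, v}"
    using simple_graph_edgeE[OF simple_graph_copies[OF E, of n]] unfolding edges_within_def by blast
  then obtain x y where xy: "u = j * k + x" "v = j * k + y" "x \<in> C" "y \<in> C"
    using e unfolding edges_within_def by auto
  then have "{x, y} \<in> E"
    using pair_in_copies_iff[OF E j, of x v] e uv C unfolding edges_within_def by auto
  then show "e \<in> (`) ((+) (j * k)) ` edges_within E C"
    unfolding edges_within_def using xy uv by (intro image_eqI[of _ _ "{x, y}"]) auto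
next
  fix e assume "e \<in> (`) ((+) (j * k)) ` edges_within E C"
  then obtain e' where "e' \<in> E" "e' \<subseteq> C" "e = (+) (j * k) ` e'" unfolding edges_within_def by blast
  moreover from this have "e \<in> copies n k E" unfolding copies_def using j by (intro UN_I[of j]) simp_all
  ultimately show "e \<in> edges_within (copies n k E) ((+) (j * k) ` C)"
    unfolding edges_within_def by (simp add: image_mono)
qed

lemma is_path_copies:
  assumes E: "simple_graph k E" and j: "j < n div k" and C: "C \<subseteq> {..<k}" and p: "is_path E C"
  shows "is_path (copies n k E) ((+) (j * k) ` C)"
proof -
  obtain vs where vs: "distinct vs" "vs \<noteq> []" "set vs = C"
    "edges_within E C = {{vs ! i, vs ! Suc i} |i. Suc i < length vs}"
    using p unfolding is_path_def by auto
  have "edges_within (copies n k E) ((+) (j * k) ` C)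
      = {(+) (j * k) ` {vs ! i, vs ! Suc i} |i. Suc i < length vs}"
    unfolding edges_within_copies[OF E j C] vs(4) by blast
  also have "\<dots> = {{map ((+) (j * k)) vs ! i, map ((+) (j * k)) vs ! Suc i} |i. Suc i < length (map ((+) (j * k)) vs)}"
    by (intro Collect_cong iff_exI) (auto simp: Suc_lessD)
  finally have "edges_within (copies n k E) ((+) (j * k) ` C) = \<dots>" .
  then show ?thesis unfolding is_path_def using vs(1-3)
    by (intro exI[of _ "map ((+) (j * k)) vs"]) (simp add: distinct_map)
qed

lemma is_cycle_copies:
  assumes E: "simple_graph k E" and j: "j < n div k" and C: "C \<subseteq> {..<k}" and p: "is_cycle E C"
  shows "is_cycle (copies n k E) ((+) (j * k) ` C)"
proof -
  obtain vs where vs: "distinct vs" "length vs \<ge> 3" "set vs = C"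
    "edges_within E C = {{vs ! i, vs ! (Suc i mod length vs)} |i. i < length vs}"
    using p unfolding is_cycle_def by auto
  let ?ws = "map ((+) (j * k)) vs"
  have "Suc i mod length vs < length vs" for i using vs(2) by (intro mod_less_divisor) linarith
  then have "?ws ! (Suc i mod length vs) = j * k + vs ! (Suc i mod length vs)" for i by simp
  then have eq: "{(+) (j * k) ` {vs ! i, vs ! (Suc i mod length vs)} |i. i < length vs}
      = {{?ws ! i, ?ws ! (Suc i mod length ?ws)} |i. i < length ?ws}"
    by (intro Collect_cong iff_exI) auto
  have "edges_within (copies n k E) ((+) (j * k) ` C)
      = {(+) (j * k) ` {vs ! i, vs ! (Suc i mod length vs)} |i. i < length vs}"
    unfolding edges_within_copies[OF E j C] vs(4) by blast
  note this[unfolded eq]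
  then show ?thesis unfolding is_cycle_def using vs(1-3)
    by (intro exI[of _ ?ws]) (simp add: distinct_map)
qed

section \<open>Components of a union of copies\<close>

lemma component_subset:
  assumes "simple_graph n E" "C \<in> components n E"
  shows "C \<subseteq> {..<n}"
proof -
  obtain u where u: "u < n" "C = {(u, v). {u, v} \<in> E}\<^sup>* `` {u}"
    using assms(2) unfolding components_def quotient_def by auto
  have "v < n" if "(u, v) \<in> {(u, v). {u, v} \<in> E}\<^sup>*" for v
    using that by induction (use u simple_graphD[OF assms(1)] in auto)
  then show ?thesis using u by auto
qed

lemma equiv_connected: "equiv UNIV ({(u, v). {u, v} \<in> E}\<^sup>*)"
proof -
  have "sym ({(u, v). {u, v} \<in> E}\<^sup>*)" by (rule sym_rtrancl) (auto simp: sym_def insert_commute)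
  then show ?thesis by (auto simp: equiv_def refl_rtrancl trans_rtrancl)
qed

lemma components_disjoint:
  assumes "C \<in> components n E" "D \<in> components n E" "x \<in> C" "x \<in> D"
  shows "C = D"
  using quotient_disj[OF equiv_connected, of C E D] assms
  unfolding components_def quotient_def by blast

lemma Union_components:
  assumes "simple_graph n E"
  shows "\<Union> (components n E) = {..<n}"
proof
  show "\<Union> (components n E) \<subseteq> {..<n}" using component_subset[OF assms] by blast
  show "{..<n} \<subseteq> \<Union> (components n E)" unfolding components_def quotient_def by auto
qed

lemma edge_in_component:
  assumes "simple_graph n E" "e \<in> E"
  shows "\<exists>C\<in>components n E. e \<subseteq> C"
proof -
  obtain u v where uv: "e = {u, v}" "u < n" using simple_graph_edgeE[OF assms] by metis
  have "{(u, v). {u, v} \<in> E}\<^sup>* `` {u} \<in> components n E"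
    unfolding components_def using uv by (intro quotientI) simp
  moreover have "e \<subseteq> {(u, v). {u, v} \<in> E}\<^sup>* `` {u}" using uv assms(2) by auto
  ultimately show ?thesis by blast
qed

text \<open>The components are the shifted components of the pattern (\<open>?P1\<close>) and the
  leftover vertices as singletons (\<open>?P2\<close>). So cycles arise exactly from cycles of the
  pattern, and a pattern without cycles leaves a budget of only \<open>\<epsilon> * n\<close>
  edges.\<close>

lemma copies_cycles_and_paths:
  assumes k: "k > 0" and E: "cycles_and_paths k E"
  shows "cycles_and_paths n (copies n k E)"
    and "C \<in> cycles k E \<Longrightarrow> j < n div k \<Longrightarrow> (+) (j * k) ` C \<in> cycles n (copies n k E)"
    and "cycles k E = {} \<Longrightarrow> cycles n (copies n k E) = {}"
proof -
  let ?P1 = "{(+) (j * k) ` C |j C. j < n div k \<and> C \<in> components k E}"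
  let ?P2 = "{{x} |x. n div k * k \<le> x \<and> x < n}"
  have sE: "simple_graph k E" and comp: "\<And>C. C \<in> components k E \<Longrightarrow> is_cycle E C \<or> is_path E C"
    using E unfolding cycles_and_paths_def by auto
  note sub = component_subset[OF sE]
  have U: "\<Union>(?P1 \<union> ?P2) = {..<n}"
  proof (intro equalityI subsetI)
    fix x assume "x \<in> \<Union>(?P1 \<union> ?P2)"
    then consider D where "D \<in> ?P1" "x \<in> D" | D where "D \<in> ?P2" "x \<in> D" by blast
    then show "x \<in> {..<n}"
    proof cases
      case 1
      then obtain j C y where "j < n div k" "C \<in> components k E" "y \<in> C" "x = j * k + y" by auto
      then show ?thesis using block_less[of j n k y] sub by auto
    qed auto
  next
    fix x assume x: "x \<in> {..<n}"
    show "x \<in> \<Union>(?P1 \<union> ?P2)"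
    proof (cases "x < n div k * k")
      case True
      then have "x div k < n div k" by (simp add: div_less_iff_less_mult k)
      moreover obtain C where "C \<in> components k E" "x mod k \<in> C"
        using Union_components[OF sE] k by (metis UnionE lessThan_iff mod_less_divisor)
      moreover have "x = x div k * k + x mod k" by simp
      ultimately show ?thesis by blast
    next
      case False
      then have "{x} \<in> ?P2" using x by auto
      then show ?thesis by blast
    qed
  qed
  have blk: "j = i \<and> C = D" if *: "j < n div k" "C \<in> components k E" "D \<in> components k E"
    "(+) (j * k) ` C \<inter> (+) (i * k) ` D \<noteq> {}" for j i C D
  proof -
    obtain x y where xy: "x \<in> C" "y \<in> D" "j * k + x = i * k + y" using *(4) by auto
    then have "j = i" "x = y" using block_eq_iff[of x k y j i] sub * by blast+
    then show ?thesis using components_disjoint *(2,3) xy by metis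
  qed
  have disj: "disjoint (?P1 \<union> ?P2)"
    unfolding disjoint_def
  proof (intro ballI impI, rule ccontr)
    fix a b assume ab: "a \<in> ?P1 \<union> ?P2" "b \<in> ?P1 \<union> ?P2" "a \<noteq> b" "a \<inter> b \<noteq> {}"
    \<comment> \<open>Applying \<open>block_less\<close> with \<open>n div k * k\<close> in place of
      \<open>n\<close> separates the copies from the leftover vertices.\<close>
    have small: "x < n div k * k" if "c \<in> ?P1" "x \<in> c" for c x
    proof -
      obtain j C y where "j < n div k" "C \<in> components k E" "y \<in> C" "x = j * k + y" using \<open>c \<in> ?P1\<close> \<open>x \<in> c\<close> by auto
      then show ?thesis using block_less[of j "n div k * k" k y] sub k by auto
    qed
    have large: "n div k * k \<le> x" if "c \<in> ?P2" "x \<in> c" for c x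
      using that by auto
    consider "a \<in> ?P1" "b \<in> ?P1" | "a \<in> ?P1" "b \<in> ?P2" | "a \<in> ?P2" "b \<in> ?P1" | "a \<in> ?P2" "b \<in> ?P2"
      using ab by blast
    then show False
    proof cases
      case 1
      then obtain j C i D where *: "j < n div k" "C \<in> components k E" "a = (+) (j * k) ` C"
        "i < n div k" "D \<in> components k E" "b = (+) (i * k) ` D" by blast
      then show False using blk[OF *(1,2,5), of i] ab(3,4) by simp
    next
      case 2
      obtain x where "x \<in> a" "x \<in> b" using ab(4) by blast
      then show False using small[OF 2(1)] large[OF 2(2)] by (meson not_le)
    next
      case 3
      obtain x where "x \<in> a" "x \<in> b" using ab(4) by blast
      then show False using large[OF 3(1)] small[OF 3(2)] by (meson not_le)
    next
      case 4 then show False using ab by auto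
    qed
  qed
  have edges: "\<exists>C\<in>?P1 \<union> ?P2. e \<subseteq> C" if "e \<in> copies n k E" for e
  proof -
    obtain j e' where "j < n div k" "e' \<in> E" "e = (+) (j * k) ` e'" using \<open>e \<in> _\<close> unfolding copies_def by auto
    moreover obtain C where "C \<in> components k E" "e' \<subseteq> C" using edge_in_component[OF sE \<open>e' \<in> E\<close>] by blast
    ultimately show ?thesis by (intro bexI[of _ "(+) (j * k) ` C"]) auto
  qed
  have kind1: "is_cycle (copies n k E) D \<or> is_path (copies n k E) D" if "D \<in> ?P1" for D
  proof -
    obtain j C where jC: "j < n div k" "C \<in> components k E" "D = (+) (j * k) ` C" using \<open>D \<in> ?P1\<close> by blast
    show ?thesis
      using comp[OF jC(2)] is_cycle_copies[OF sE jC(1) sub[OF jC(2)]] is_path_copies[OF sE jC(1) sub[OF jC(2)]]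
      unfolding jC(3) by blast
  qed
  have kind2: "is_path (copies n k E) D" if "D \<in> ?P2" for D
    using that is_path_singleton[OF simple_graph_copies[OF sE]] by auto
  have kind: "is_cycle (copies n k E) D \<or> is_path (copies n k E) D" if "D \<in> ?P1 \<union> ?P2" for D
    using that kind1[of D] kind2[of D] by (elim UnE) simp_all
  note * = cycles_and_pathsI[OF simple_graph_copies[OF sE] U disj edges kind]
  show "cycles_and_paths n (copies n k E)" by (rule *(1))
  have cyc: "cycles n (copies n k E) = {D \<in> ?P1 \<union> ?P2. is_cycle (copies n k E) D}" by (rule *(2))
  show "(+) (j * k) ` C \<in> cycles n (copies n k E)" if "C \<in> cycles k E" "j < n div k"
  proof -
    have C: "C \<in> components k E" "is_cycle E C" using that(1) unfolding cycles_def by simp_all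
    have "(+) (j * k) ` C \<in> ?P1 \<union> ?P2" using C(1) that(2) by blast
    then show ?thesis
      using is_cycle_copies[OF sE that(2) sub[OF C(1)] C(2)] cyc by simp
  qed
  assume "cycles k E = {}"
  then have path: "is_path E C" if "C \<in> components k E" for C using comp[OF that] that unfolding cycles_def by auto
  have path1: "is_path (copies n k E) D" if "D \<in> ?P1" for D
  proof -
    obtain j C where jC: "j < n div k" "C \<in> components k E" "D = (+) (j * k) ` C" using \<open>D \<in> ?P1\<close> by blast
    show ?thesis
      using path[OF jC(2)] is_path_copies[OF sE jC(1) sub[OF jC(2)]] unfolding jC(3) by blast
  qed
  have "\<not> is_cycle (copies n k E) D" if "D \<in> ?P1 \<union> ?P2" for D
    using that path1[of D] kind2[of D] is_path_imp_not_is_cycle by (elim UnE) simp_all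
  then show "cycles n (copies n k E) = {}" unfolding cyc by blast
qed

section \<open>Runs on copies of patterns\<close>

lemma prob_space_random_tape: "prob_space random_tape"
  unfolding random_tape_def by (intro prob_space_PiM measure_pmf.prob_space_axioms)

text \<open>Each input fails with probability at most \<open>1 / n\<close>, so fewer than
  \<open>n\<close> sets of failing tapes cannot cover the whole tape space.\<close>

lemma simultaneous_success:
  assumes sol: "solves_whp \<epsilon> n T A" and F: "finite F" "card F < n"
    and cp: "\<And>E. E \<in> F \<Longrightarrow> cycles_and_paths n E"
  obtains \<omega> where "\<And>E. E \<in> F \<Longrightarrow> successful_run \<epsilon> n T A E \<omega>"
proof (cases "F = {}")
  case False
  interpret prob_space random_tape by (rule prob_space_random_tape)
  define S where "S E = {\<omega> \<in> space random_tape. successful_run \<epsilon> n T A E \<omega>}" for E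
  have "card F > 0" using False F(1) by (simp add: card_gt_0_iff)
  then have n: "n \<ge> 2" using F(2) by linarith
  have S: "prob (S E) \<ge> 1 - 1 / real n" if "E \<in> F" for E
    using sol cp[OF that] unfolding solves_whp_def S_def by simp
  \<comment> \<open>A non-measurable set would get measure 0, which is below
    \<open>1 - 1 / n\<close> because \<open>n \<ge> 2\<close>.\<close>
  have ev: "S E \<in> events" if "E \<in> F" for E
  proof (rule ccontr)
    assume "S E \<notin> events"
    then have "prob (S E) = 0" by (rule measure_notin_sets)
    then show False using S[OF that] n by (simp add: field_simps)
  qed
  have "prob (\<Union>E\<in>F. space random_tape - S E) \<le> (\<Sum>E\<in>F. prob (space random_tape - S E))"
    by (rule finite_measure_subadditive_finite) (use F ev in auto)
  also have "\<dots> \<le> (\<Sum>E\<in>F. 1 / real n)"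
  proof (rule sum_mono)
    fix E assume "E \<in> F"
    then show "prob (space random_tape - S E) \<le> 1 / real n"
      using prob_compl[OF ev[OF \<open>E \<in> F\<close>]] S[OF \<open>E \<in> F\<close>] by simp
  qed
  also have "\<dots> < 1" using F(2) by simp
  finally have "(\<Union>E\<in>F. space random_tape - S E) \<noteq> space random_tape" using prob_space by auto
  then obtain \<omega> where "\<forall>E\<in>F. \<omega> \<in> S E" "\<omega> \<in> space random_tape" by blast
  then show thesis using that unfolding S_def by blast
qed (use that in simp)

lemma agree_in_copy:
  assumes run: "successful_run \<epsilon> n T A (copies n k E) \<omega>" and E: "simple_graph k E"
    and j: "j < n div k" and xy: "{x, y} \<in> E"
  shows "removes A (copies n k E) \<omega> T (j * k + x) (j * k + y)
    \<longleftrightarrow> removes A (copies n k E) \<omega> T (j * k + y) (j * k + x)"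
proof -
  have "{j * k + x, j * k + y} \<in> copies n k E"
    using pair_in_copies_iff[OF E j simple_graphD(1)[OF E xy]] xy by blast
  then show ?thesis using run unfolding successful_run_def by blast
qed

text \<open>The shifted \<open>C\<close> is a cycle of the whole input and must lose an edge. The
  order of \<open>x\<close> and \<open>y\<close> matters: \<open>x\<close> is the end whose output
  removes the edge.\<close>

lemma cycle_cut_in_copy:
  assumes run: "successful_run \<epsilon> n T A (copies n k E) \<omega>" and E: "cycles_and_paths k E"
    and C: "C \<in> cycles k E" and j: "j < n div k"
  obtains x y where "{x, y} \<in> E" "removes A (copies n k E) \<omega> T (j * k + x) (j * k + y)"
proof -
  let ?R = "{{u, v} |u v. {u, v} \<in> copies n k E \<and> removes A (copies n k E) \<omega> T u v}"
  have sE: "simple_graph k E" using E unfolding cycles_and_paths_def by simp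
  have "k > 0" using j by (cases k) auto
  then have "(+) (j * k) ` C \<in> cycles n (copies n k E)" using copies_cycles_and_paths(2) E C j by blast
  then have "?R \<inter> edges_within (copies n k E) ((+) (j * k) ` C) \<noteq> {}"
    using run unfolding successful_run_def almost_spanning_forest_def by blast
  moreover have "C \<subseteq> {..<k}" using C component_subset[OF sE] unfolding cycles_def by blast
  ultimately obtain e where e: "e \<in> E" "(+) (j * k) ` e \<in> ?R"
    unfolding edges_within_copies[OF sE j \<open>C \<subseteq> {..<k}\<close>] by (auto simp: edges_within_def)
  obtain x y where xy: "e = {x, y}" using simple_graph_edgeE[OF sE e(1)] by metis
  obtain u v where uv: "{j * k + x, j * k + y} = {u, v}" "removes A (copies n k E) \<omega> T u v"
    using e(2) unfolding xy by auto
  have "{y, x} \<in> E" "{x, y} \<in> E" using e(1) xy by (auto simp: insert_commute)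
  then show thesis using that uv by (metis doubleton_eq_iff)
qed

text \<open>Without cycles the budget is \<open>\<epsilon> * n\<close>. The condition
  \<open>x < y\<close> makes each edge count once, and the blocks are disjoint, so the counted
  triples inject into the set of removed edges.\<close>

lemma few_cuts_in_copies:
  assumes run: "successful_run \<epsilon> n T A (copies n k E) \<omega>" and E: "cycles_and_paths k E"
    and no_cyc: "cycles k E = {}" and k: "k > 0"
  shows "real (\<Sum>j<n div k. card {(x, y). x < y \<and> {x, y} \<in> E
      \<and> removes A (copies n k E) \<omega> T (j * k + x) (j * k + y)}) \<le> \<epsilon> * real n"
proof -
  let ?E = "copies n k E"
  let ?R = "{{u, v} |u v. {u, v} \<in> ?E \<and> removes A ?E \<omega> T u v}"
  define D where "D j = {(x, y). x < y \<and> {x, y} \<in> E \<and> removes A ?E \<omega> T (j * k + x) (j * k + y)}" for j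
  have sE: "simple_graph k E" using E unfolding cycles_and_paths_def by simp
  have D_sub: "D j \<subseteq> {..<k} \<times> {..<k}" for j
    unfolding D_def using simple_graphD[OF sE] by auto
  then have fin: "finite (D j)" for j by (rule finite_subset) simp
  have "?E \<subseteq> Pow {..<n}" using simple_graph_copies[OF sE] unfolding simple_graph_def by blast
  then have finR: "finite ?R" by (intro finite_subset[of ?R ?E] finite_subset[of ?E "Pow {..<n}"]) auto
  have "(\<Sum>j<n div k. card (D j)) = card (SIGMA j:{..<n div k}. D j)" using fin by simp
  also have "\<dots> \<le> card ?R"
  proof (rule card_inj_on_le)
    show "inj_on (\<lambda>(j, x, y). {j * k + x, j * k + y}) (SIGMA j:{..<n div k}. D j)"
    proof (rule inj_onI)
      fix p q
      assume pq: "p \<in> (SIGMA j:{..<n div k}. D j)" "q \<in> (SIGMA j:{..<n div k}. D j)"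
        "(case p of (j, x, y) \<Rightarrow> {j * k + x, j * k + y}) = (case q of (j, x, y) \<Rightarrow> {j * k + x, j * k + y})"
      obtain i x y j u v where p: "p = (i, x, y)" and q: "q = (j, u, v)" by (metis prod_cases3)
      have a: "(x, y) \<in> D i" "(u, v) \<in> D j" and eq: "{i * k + x, i * k + y} = {j * k + u, j * k + v}"
        using pq unfolding p q by simp_all
      have lt: "x < k" "y < k" "u < k" "v < k" "x < y" "u < v" using a D_sub unfolding D_def by auto
      from eq consider "i * k + x = j * k + u" "i * k + y = j * k + v" | "i * k + x = j * k + v" "i * k + y = j * k + u"
        by (auto simp: doubleton_eq_iff)
      then have "i = j \<and> x = u \<and> y = v"
      proof cases
        case 1 then show ?thesis using lt block_eq_iff by metis
      next
        case 2
        then have "x = v" "y = u" using lt block_eq_iff by metis+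
        then show ?thesis using lt by simp
      qed
      then show "p = q" unfolding p q by simp
    qed
    show "(\<lambda>(j, x, y). {j * k + x, j * k + y}) ` (SIGMA j:{..<n div k}. D j) \<subseteq> ?R"
    proof clarify
      fix j x y assume j: "j < n div k" and "(x, y) \<in> D j"
      then have xy: "{x, y} \<in> E" "removes A ?E \<omega> T (j * k + x) (j * k + y)" unfolding D_def by auto
      then have "{j * k + x, j * k + y} \<in> ?E"
        using pair_in_copies_iff[OF sE j simple_graphD(1)[OF sE xy(1)]] by blast
      then show "\<exists>u v. {j * k + x, j * k + y} = {u, v} \<and> {u, v} \<in> ?E \<and> removes A ?E \<omega> T u v"
        using xy(2) by blast
    qed
  qed (rule finR)
  finally have "real (\<Sum>j<n div k. card (D j)) \<le> real (card ?R)" by (simp only: of_nat_le_iff)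
  also have "\<dots> \<le> \<epsilon> * real n"
    using run copies_cycles_and_paths(3)[OF k E no_cyc, of n]
    unfolding successful_run_def almost_spanning_forest_def by simp
  finally show ?thesis unfolding D_def .
qed

section \<open>Locality of runs\<close>

text \<open>Information travels one edge per round. The set \<open>S t\<close> holds vertices whose
  memories agree after \<open>t\<close> rounds; it shrinks so that all neighbours of a vertex in
  \<open>S (Suc t)\<close> still lie in \<open>S t\<close>.\<close>

lemma memory_after_cong:
  assumes "\<And>t v. v \<in> S t \<Longrightarrow> neighbours E v = neighbours E' v"
    and "\<And>t v. v \<in> S (Suc t) \<Longrightarrow> v \<in> S t \<and> neighbours E v \<subseteq> S t"
  shows "v \<in> S t \<Longrightarrow> memory_after A E \<omega> t v = memory_after A E' \<omega> t v"
proof (induction t arbitrary: v)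
  case 0
  then show ?case using assms(1) by simp
next
  case (Suc t)
  have "(\<lambda>u. if u \<in> neighbours E v then Some (alg_send A \<omega> (memory_after A E \<omega> t u) v) else None)
      = (\<lambda>u. if u \<in> neighbours E' v then Some (alg_send A \<omega> (memory_after A E' \<omega> t u) v) else None)"
    using Suc.IH assms(1)[OF Suc.prems] assms(2)[OF Suc.prems] by (intro ext) auto
  then show ?case using Suc.IH assms(2)[OF Suc.prems] by simp
qed

text \<open>The shrinking sets are described on the pattern and shifted into block \<open>j\<close>.
  Other blocks have no influence, since no edge leaves a block.\<close>

lemma memory_after_copies_cong:
  assumes E: "simple_graph k E" "simple_graph k E'" and j: "j < n div k"
    and S: "\<And>t x. x \<in> S t \<Longrightarrow> x < k \<and> neighbours E x = neighbours E' x"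
      "\<And>t x. x \<in> S (Suc t) \<Longrightarrow> x \<in> S t \<and> neighbours E x \<subseteq> S t"
    and x: "x \<in> S t"
  shows "memory_after A (copies n k E) \<omega> t (j * k + x) = memory_after A (copies n k E') \<omega> t (j * k + x)"
proof (rule memory_after_cong[where S = "\<lambda>t. (+) (j * k) ` S t"])
  fix t v assume "v \<in> (+) (j * k) ` S t"
  then obtain y where "v = j * k + y" "y \<in> S t" by blast
  then show "neighbours (copies n k E) v = neighbours (copies n k E') v"
    using S(1)[of y t] neighbours_copies[OF E(1) j, of y] neighbours_copies[OF E(2) j, of y] by simp
next
  fix t v assume "v \<in> (+) (j * k) ` S (Suc t)"
  then obtain y where "v = j * k + y" "y \<in> S (Suc t)" by blast
  then show "v \<in> (+) (j * k) ` S t \<and> neighbours (copies n k E) v \<subseteq> (+) (j * k) ` S t"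
    using S(1)[of y "Suc t"] S(2)[of y t] neighbours_copies[OF E(1) j, of y] by (simp add: image_mono)
qed (use x in simp)

section \<open>The cycle and the two paths\<close>

definition whole_cycle :: "nat \<Rightarrow> nat set set" where
  "whole_cycle k = {{i, Suc i} |i. Suc i < k} \<union> {{0, k - 1}}"

definition whole_path :: "nat \<Rightarrow> nat set set" where
  "whole_path k = {{i, Suc i} |i. Suc i < k}"

text \<open>For \<open>0 < b\<close> and \<open>b < k\<close> this is the cycle without the edge
  between \<open>b - 1\<close> and \<open>b\<close>, keeping the closing edge that
  \<open>whole_path\<close> lacks.\<close>

definition rotated_path :: "nat \<Rightarrow> nat \<Rightarrow> nat set set" where
  "rotated_path k b = {{i, Suc i} |i. Suc i < k \<and> Suc i \<noteq> b} \<union> {{0, k - 1}}"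

lemma pair_in_whole_cycle_iff:
  "{x, y} \<in> whole_cycle k \<longleftrightarrow>
    y = Suc x \<and> y < k \<or> x = Suc y \<and> x < k \<or> x = 0 \<and> y = k - 1 \<or> x = k - 1 \<and> y = 0"
  unfolding whole_cycle_def by (auto simp: doubleton_eq_iff)

lemma pair_in_whole_path_iff:
  "{x, y} \<in> whole_path k \<longleftrightarrow> y = Suc x \<and> y < k \<or> x = Suc y \<and> x < k"
  unfolding whole_path_def by (auto simp: doubleton_eq_iff)

lemma pair_in_rotated_path_iff:
  "{x, y} \<in> rotated_path k b \<longleftrightarrow> y = Suc x \<and> y < k \<and> y \<noteq> b \<or> x = Suc y \<and> x < k \<and> x \<noteq> b
    \<or> x = 0 \<and> y = k - 1 \<or> x = k - 1 \<and> y = 0"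
  unfolding rotated_path_def by (auto simp: doubleton_eq_iff)

lemma simple_graph_whole_cycle: "k \<ge> 3 \<Longrightarrow> simple_graph k (whole_cycle k)"
  unfolding simple_graph_def whole_cycle_def by fastforce

lemma simple_graph_whole_path: "simple_graph k (whole_path k)"
  unfolding simple_graph_def whole_path_def by fastforce

lemma simple_graph_rotated_path: "k \<ge> 3 \<Longrightarrow> simple_graph k (rotated_path k b)"
  unfolding simple_graph_def rotated_path_def by fastforce

lemma edges_within_whole:
  assumes "simple_graph k E"
  shows "edges_within E {..<k} = E"
  using assms unfolding simple_graph_def edges_within_def by auto

lemma is_cycle_whole_cycle:
  assumes k: "k \<ge> 3"
  shows "is_cycle (whole_cycle k) {..<k}"
proof -
  have "whole_cycle k = {{[0..<k] ! i, [0..<k] ! (Suc i mod length [0..<k])} |i. i < length [0..<k]}"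
  proof (intro equalityI subsetI)
    fix e assume "e \<in> whole_cycle k"
    then consider i where "e = {i, Suc i}" "Suc i < k" | "e = {0, k - 1}" unfolding whole_cycle_def by blast
    then show "e \<in> {{[0..<k] ! i, [0..<k] ! (Suc i mod length [0..<k])} |i. i < length [0..<k]}"
    proof cases
      case 1 then show ?thesis by (intro CollectI exI[of _ i]) simp
    next
      case 2 then show ?thesis using k by (intro CollectI exI[of _ "k - 1"]) (simp add: insert_commute)
    qed
  next
    fix e assume "e \<in> {{[0..<k] ! i, [0..<k] ! (Suc i mod length [0..<k])} |i. i < length [0..<k]}"
    then obtain i where i: "i < k" "e = {[0..<k] ! i, [0..<k] ! (Suc i mod k)}" by auto
    then have e: "e = {i, Suc i mod k}" using k by simp
    show "e \<in> whole_cycle k"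
    proof (cases "Suc i < k")
      case True then show ?thesis unfolding e pair_in_whole_cycle_iff by simp
    next
      case False
      then have "Suc i = k" using i by simp
      then show ?thesis unfolding e pair_in_whole_cycle_iff by auto
    qed
  qed
  then show ?thesis unfolding is_cycle_def edges_within_whole[OF simple_graph_whole_cycle[OF k]]
    using k by (intro exI[of _ "[0..<k]"]) auto
qed

lemma is_path_whole_path:
  assumes k: "k > 0"
  shows "is_path (whole_path k) {..<k}"
proof -
  have "whole_path k = {{[0..<k] ! i, [0..<k] ! Suc i} |i. Suc i < length [0..<k]}"
    unfolding whole_path_def by (intro Collect_cong iff_exI) auto
  then show ?thesis unfolding is_path_def edges_within_whole[OF simple_graph_whole_path]
    using k by (intro exI[of _ "[0..<k]"]) auto
qed

lemma is_path_rotated_path: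
  assumes k: "k \<ge> 3" and b: "0 < b" "b < k"
  shows "is_path (rotated_path k b) {..<k}"
proof -
  obtain m where m: "k = b + m" "0 < m" using b by (metis less_imp_add_positive)
  \<comment> \<open>The path starts at \<open>b\<close>, climbs to \<open>k - 1\<close>, takes the
    closing edge to 0 and ends at \<open>b - 1\<close>. Writing \<open>k\<close> as
    \<open>b + m\<close> avoids truncated subtraction.\<close>
  let ?vs = "[b..<b + m] @ [0..<b]"
  have nth: "?vs ! i = (if i < m then b + i else i - m)" if "i < b + m" for i
    using that by (simp add: nth_append)
  have "rotated_path k b = {{?vs ! i, ?vs ! Suc i} |i. Suc i < length ?vs}"
  proof (intro equalityI subsetI)
    fix e assume "e \<in> rotated_path k b"
    then consider i where "e = {i, Suc i}" "Suc i < k" "Suc i \<noteq> b" | "e = {0, k - 1}"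
      unfolding rotated_path_def by blast
    then show "e \<in> {{?vs ! i, ?vs ! Suc i} |i. Suc i < length ?vs}"
    proof cases
      case 1
      show ?thesis
      proof (cases "i < b")
        case True
        then have "Suc i < b" using 1(3) by linarith
        then show ?thesis using 1 m by (intro CollectI exI[of _ "i + m"]) (simp add: nth)
      next
        case False
        then show ?thesis using 1 m by (intro CollectI exI[of _ "i - b"]) (auto simp add: nth)
      qed
    next
      case 2
      then show ?thesis using m b by (intro CollectI exI[of _ "m - 1"]) (simp add: nth insert_commute)
    qed
  next
    fix e assume "e \<in> {{?vs ! i, ?vs ! Suc i} |i. Suc i < length ?vs}"
    then obtain i where i: "Suc i < length ?vs" "e = {?vs ! i, ?vs ! Suc i}" by blast
    then have "Suc i < b + m" by simp
    consider "Suc i < m" | "Suc i = m" | "m < Suc i" by linarith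
    then show "e \<in> rotated_path k b"
      using \<open>Suc i < b + m\<close> b m unfolding i(2) pair_in_rotated_path_iff by cases (auto simp add: nth)
  qed
  then show ?thesis unfolding is_path_def edges_within_whole[OF simple_graph_rotated_path[OF k]]
    using b m by (intro exI[of _ ?vs]) auto
qed

lemma whole_patterns:
  assumes k: "k \<ge> 3" and b: "0 < b" "b < k"
  shows "cycles_and_paths k (whole_cycle k)" "{..<k} \<in> cycles k (whole_cycle k)"
    and "cycles_and_paths k (whole_path k)" "cycles k (whole_path k) = {}"
    and "cycles_and_paths k (rotated_path k b)" "cycles k (rotated_path k b) = {}"
proof -
  have sub: "e \<subseteq> {..<k}" if "simple_graph k E" "e \<in> E" for e E
    using edges_within_whole[OF that(1)] that(2) unfolding edges_within_def by blast
  have k0: "k > 0" using k by simp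
  note c = simple_graph_whole_cycle[OF k] and p = simple_graph_whole_path[of k]
    and r = simple_graph_rotated_path[OF k, of b]
  note C = is_cycle_whole_cycle[OF k] and P = is_path_whole_path[OF k0] and R = is_path_rotated_path[OF k b]
  show "cycles_and_paths k (whole_cycle k)" "{..<k} \<in> cycles k (whole_cycle k)"
    using cycles_and_paths_single[OF c sub[OF c] subset_refl] C by blast+
  show "cycles_and_paths k (whole_path k)" "cycles k (whole_path k) = {}"
    using cycles_and_paths_single[OF p sub[OF p] subset_refl] P by blast+
  show "cycles_and_paths k (rotated_path k b)" "cycles k (rotated_path k b) = {}"
    using cycles_and_paths_single[OF r sub[OF r] subset_refl] R by blast+
qed

text \<open>
  With \<open>2 * (2 * T + 2)\<close> vertices on the cycle, the horizon of a vertex cannot contain both edges that are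
  missing in one of the two paths, namely those at distance \<open>2 * T + 2\<close> from each other on the cycle.
\<close>

lemma whole_cycle_view:
  assumes T: "k = 4 * T + 4" and j: "j < n div k" and x: "x < k"
  shows "\<exists>E \<in> {whole_path k, rotated_path k (2 * T + 2)}. neighbours E x = neighbours (whole_cycle k) x \<and>
    memory_after A (copies n k (whole_cycle k)) \<omega> T (j * k + x) = memory_after A (copies n k E) \<omega> T (j * k + x)"
proof -
  let ?b = "2 * T + 2"
  have k: "k \<ge> 3" using T by simp
  note c = simple_graph_whole_cycle[OF k] and p = simple_graph_whole_path[of k]
    and r = simple_graph_rotated_path[OF k, of ?b]
  show ?thesis
  \<comment> \<open>In the first case \<open>x\<close> has distance more than \<open>T\<close> from
    both ends 0 and \<open>k - 1\<close> of the closing edge, so it cannot notice its absence in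
    \<open>whole_path k\<close>.\<close>
  proof (cases "T + 1 \<le> x \<and> x + T + 2 \<le> k")
    case True
    define S where "S t = {y. t + 1 \<le> y \<and> y + t + 2 \<le> k}" for t
    have S1: "y < k \<and> neighbours (whole_cycle k) y = neighbours (whole_path k) y" if "y \<in> S t" for t y
      using that unfolding S_def neighbours_def pair_in_whole_cycle_iff pair_in_whole_path_iff by auto
    have S2: "y \<in> S t \<and> neighbours (whole_cycle k) y \<subseteq> S t" if "y \<in> S (Suc t)" for t y
      using that unfolding S_def neighbours_def pair_in_whole_cycle_iff by auto
    have xS: "x \<in> S T" using True unfolding S_def by simp
    show ?thesis
      using S1[OF xS] memory_after_copies_cong[where S = S, OF c p j S1 S2 xS]
      by (intro bexI[of _ "whole_path k"]) simp_all
  next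
    case False
    \<comment> \<open>These vertices have distance more than \<open>t\<close> from
      \<open>?b - 1\<close> and \<open>?b\<close>. The bound \<open>t \<le> T\<close> keeps 0 and
      \<open>k - 1\<close> in the set, so that crossing the closing edge does not leave it.\<close>
    define S where "S t = {y. t \<le> T \<and> y < k \<and> (y + t + 2 \<le> ?b \<or> ?b + 1 + t \<le> y)}" for t
    have S1: "y < k \<and> neighbours (whole_cycle k) y = neighbours (rotated_path k ?b) y" if "y \<in> S t" for t y
      using that unfolding S_def neighbours_def pair_in_whole_cycle_iff pair_in_rotated_path_iff by auto
    have S2: "y \<in> S t \<and> neighbours (whole_cycle k) y \<subseteq> S t" if "y \<in> S (Suc t)" for t y
      using that T unfolding S_def neighbours_def pair_in_whole_cycle_iff by auto
    \<comment> \<open>Here \<open>x \<le> T\<close> or \<open>x \<ge> 3 * T + 3\<close>. Both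
      inequalities defining \<open>S T\<close> hold with equality at these extremes, which explains
      \<open>k = 4 * T + 4\<close>.\<close>
    have xS: "x \<in> S T" using False x T unfolding S_def by auto
    show ?thesis
      using S1[OF xS] memory_after_copies_cong[where S = S, OF c r j S1 S2 xS]
      by (intro bexI[of _ "rotated_path k ?b"]) simp_all
  qed
qed

text \<open>In every block some vertex removes a cycle edge, and it removes the same edge in
  whichever path gives it the same view. Summing over the blocks compares their number with two
  budgets of \<open>\<epsilon> * n\<close>. The union bound over three inputs needs
  \<open>n > 3\<close>.\<close>

lemma copies_le_cuts:
  assumes sol: "solves_whp \<epsilon> n T A" and n: "n > 3" and T: "k = 4 * T + 4"
  shows "real (n div k) \<le> 2 * \<epsilon> * real n"
proof -
  let ?c = "whole_cycle k" and ?p = "whole_path k" and ?r = "rotated_path k (2 * T + 2)"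
  let ?F = "copies n k ` {?c, ?p, ?r}"
  have k: "k \<ge> 3" "k > 0" "0 < 2 * T + 2" "2 * T + 2 < k" using T by auto
  note pat = whole_patterns[OF k(1,3,4)]
  have "card ?F \<le> 3" by (rule order_trans[OF card_image_le]) (simp_all add: card_insert_if)
  then have "card ?F < n" using n by simp
  moreover have "cycles_and_paths n E" if "E \<in> ?F" for E
    using that pat copies_cycles_and_paths(1)[OF k(2)] by auto
  ultimately obtain \<omega> where run: "\<And>E. E \<in> ?F \<Longrightarrow> successful_run \<epsilon> n T A E \<omega>"
    using simultaneous_success[OF sol, of ?F] by blast
  define D where "D E j = {(x, y). x < y \<and> {x, y} \<in> E
      \<and> removes A (copies n k E) \<omega> T (j * k + x) (j * k + y)}" for E j
  have cut: "1 \<le> card (D ?p j) + card (D ?r j)" if j: "j < n div k" for j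
  proof -
    obtain x y where xy: "{x, y} \<in> ?c" "removes A (copies n k ?c) \<omega> T (j * k + x) (j * k + y)"
      using cycle_cut_in_copy[OF _ pat(1,2) j] run by blast
    have x: "x < k" using simple_graphD[OF simple_graph_whole_cycle[OF k(1)] xy(1)] by simp
    obtain E where E: "E \<in> {?p, ?r}" and nb: "neighbours E x = neighbours ?c x"
      and mem: "memory_after A (copies n k ?c) \<omega> T (j * k + x) = memory_after A (copies n k E) \<omega> T (j * k + x)"
      using whole_cycle_view[OF T j x] by blast
    have xyE: "{x, y} \<in> E" using nb xy(1) unfolding neighbours_def by auto
    have sE: "simple_graph k E" using E pat unfolding cycles_and_paths_def by auto
    have rem: "removes A (copies n k E) \<omega> T (j * k + x) (j * k + y)" using xy(2) mem unfolding removes_def by simp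
    moreover have "removes A (copies n k E) \<omega> T (j * k + y) (j * k + x)"
      using agree_in_copy[OF run sE j xyE] rem E by auto
    \<comment> \<open>\<open>D\<close> records only increasing pairs; agreement of the two ends
      allows the edge to be oriented that way.\<close>
    ultimately have "(min x y, max x y) \<in> D E j"
      using xyE simple_graphD(3)[OF sE xyE] unfolding D_def min_def max_def by (auto simp: insert_commute)
    moreover have "finite (D E j)"
      by (rule finite_subset[of _ "{..<k} \<times> {..<k}"]) (use simple_graphD[OF sE] in \<open>auto simp: D_def\<close>)
    ultimately have "1 \<le> card (D E j)" by (metis One_nat_def Suc_leI card_gt_0_iff empty_iff)
    then show ?thesis using E by auto
  qed
  have "n div k = (\<Sum>j<n div k. 1)" by simp
  also have "\<dots> \<le> (\<Sum>j<n div k. card (D ?p j) + card (D ?r j))" by (rule sum_mono) (use cut in simp)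
  also have "\<dots> = (\<Sum>j<n div k. card (D ?p j)) + (\<Sum>j<n div k. card (D ?r j))" by (rule sum.distrib)
  finally have "real (n div k) \<le> real (\<Sum>j<n div k. card (D ?p j)) + real (\<Sum>j<n div k. card (D ?r j))"
    by (simp only: of_nat_add[symmetric] of_nat_le_iff)
  moreover have "real (\<Sum>j<n div k. card (D ?p j)) \<le> \<epsilon> * real n"
    unfolding D_def using run by (intro few_cuts_in_copies pat k(2)) simp
  moreover have "real (\<Sum>j<n div k. card (D ?r j)) \<le> \<epsilon> * real n"
    unfolding D_def using run by (intro few_cuts_in_copies pat k(2)) simp
  ultimately show ?thesis by simp
qed

text \<open>The bound on \<open>n div k\<close> gives
  \<open>n < k * (2 * \<epsilon> * n + 1)\<close>, and \<open>n \<ge> 1 / (2 * \<epsilon>)\<close>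
  lets the rounding term 1 be absorbed, so \<open>n < 4 * k * \<epsilon> * n\<close>. If
  \<open>T\<close> were below \<open>1 / (32 * \<epsilon>)\<close>, then
  \<open>4 * k * \<epsilon>\<close> would be at most 1.\<close>

lemma many_rounds_small_epsilon:
  assumes sol: "solves_whp \<epsilon> n T A" and e: "0 < \<epsilon>" "\<epsilon> < 1 / 32" and n: "real n \<ge> 1 / (2 * \<epsilon>)"
  shows "real T \<ge> (1 / 32) / \<epsilon>"
proof (rule ccontr)
  assume "\<not> real T \<ge> (1 / 32) / \<epsilon>"
  then have T: "32 * real T * \<epsilon> < 1" using e by (simp add: field_simps)
  define k where "k = 4 * T + 4"
  have "1 \<le> real n * (2 * \<epsilon>)" using n e by (simp add: field_simps)
  moreover have "real n * (2 * \<epsilon>) \<le> real n * (1 / 16)" using e by (intro mult_left_mono) auto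
  ultimately have n16: "real n \<ge> 16" "1 \<le> 2 * \<epsilon> * real n" by (auto simp: mult_ac)
  then have "real (n div k) \<le> 2 * \<epsilon> * real n" using copies_le_cuts[OF sol _ k_def] by simp
  moreover have "real n < real k * (real (n div k) + 1)"
  proof -
    have "n < k * (n div k + 1)" using dividend_less_times_div[of k n] unfolding k_def by simp
    then have "real n < real (k * (n div k + 1))" by (simp only: of_nat_less_iff)
    then show ?thesis by (simp add: algebra_simps)
  qed
  ultimately have "real n < real k * (2 * \<epsilon> * real n + 1)"
    by (smt (verit) mult_left_mono of_nat_0_le_iff)
  also have "\<dots> \<le> real k * (4 * \<epsilon> * real n)" using n16 by (intro mult_left_mono) auto
  also have "\<dots> = (4 * real k * \<epsilon>) * real n" by simp
  also have "\<dots> \<le> 1 * real n"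
  proof (rule mult_right_mono)
    \<comment> \<open>Each of the two summands is less than 1/2.\<close>
    have "4 * real k * \<epsilon> = (32 * real T * \<epsilon>) / 2 + 16 * \<epsilon>" unfolding k_def by (simp add: algebra_simps)
    also have "\<dots> \<le> 1" using T e by linarith
    finally show "4 * real k * \<epsilon> \<le> 1" .
  qed simp
  finally show False by simp
qed

section \<open>Algorithms without communication\<close>

lemma edges_within_superset:
  assumes "\<And>e. e \<in> E \<Longrightarrow> e \<subseteq> C"
  shows "edges_within E C = E"
  using assms unfolding edges_within_def by auto

lemma simple_graph_empty: "simple_graph n {}"
  unfolding simple_graph_def by simp

lemma simple_graph_insert:
  assumes "u < n" "v < n" "u \<noteq> v" "simple_graph n E"
  shows "simple_graph n (insert {u, v} E)"
  using assms unfolding simple_graph_def by blast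

lemma edge_pattern:
  assumes "x < k" "y < k" "x \<noteq> y"
  shows "cycles_and_paths k {{x, y}}"
proof (rule cycles_and_paths_single(1)[where C = "{x, y}"])
  have "{{x, y}} = {{[x, y] ! i, [x, y] ! Suc i} |i. Suc i < length [x, y]}" by auto
  moreover have "edges_within {{x, y}} {x, y} = {{x, y}}" by (rule edges_within_superset) simp
  ultimately show "is_cycle {{x, y}} {x, y} \<or> is_path {{x, y}} {x, y}"
    unfolding is_path_def using assms by (intro disjI2 exI[of _ "[x, y]"]) simp
qed (use assms in \<open>auto intro!: simple_graph_insert simple_graph_empty\<close>)

text \<open>The path runs \<open>y, x, z\<close>: the middle vertex \<open>x\<close> sees two
  neighbours, whereas \<open>y\<close> sees \<open>x\<close> alone.\<close>

lemma two_edge_pattern: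
  assumes "x < k" "y < k" "z < k" "x \<noteq> y" "x \<noteq> z" "y \<noteq> z"
  shows "cycles_and_paths k {{x, y}, {x, z}}"
proof (rule cycles_and_paths_single(1)[where C = "{x, y, z}"])
  let ?vs = "[y, x, z]"
  have "Suc i < length ?vs \<longleftrightarrow> i \<in> {0, 1}" for i by auto
  then have "{{?vs ! i, ?vs ! Suc i} |i. Suc i < length ?vs} = (\<lambda>i. {?vs ! i, ?vs ! Suc i}) ` {0, 1}"
    by (simp only: Setcompr_eq_image)
  also have "\<dots> = {{x, y}, {x, z}}" by (simp add: insert_commute[of y x])
  finally have "{{x, y}, {x, z}} = {{?vs ! i, ?vs ! Suc i} |i. Suc i < length ?vs}" ..
  moreover have "edges_within {{x, y}, {x, z}} {x, y, z} = {{x, y}, {x, z}}" by (rule edges_within_superset) auto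
  ultimately show "is_cycle {{x, y}, {x, z}} {x, y, z} \<or> is_path {{x, y}, {x, z}} {x, y, z}"
    unfolding is_path_def using assms by (intro disjI2 exI[of _ ?vs]) auto
qed (use assms in \<open>auto intro!: simple_graph_insert simple_graph_empty\<close>)

lemma four_cycle_pattern:
  assumes abcd: "a < k" "b < k" "c < k" "d < k" and dist: "distinct [a, b, c, d]"
  shows "cycles_and_paths k {{a, b}, {b, c}, {c, d}, {d, a}}"
    and "{a, b, c, d} \<in> cycles k {{a, b}, {b, c}, {c, d}, {d, a}}"
proof -
  let ?E = "{{a, b}, {b, c}, {c, d}, {d, a}}" and ?vs = "[a, b, c, d]"
  have "i < length ?vs \<longleftrightarrow> i \<in> {0, 1, 2, 3}" for i by auto
  then have "{{?vs ! i, ?vs ! (Suc i mod length ?vs)} |i. i < length ?vs}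
      = (\<lambda>i. {?vs ! i, ?vs ! (Suc i mod length ?vs)}) ` {0, 1, 2, 3}"
    by (simp only: Setcompr_eq_image)
  also have "\<dots> = ?E" by simp
  finally have "?E = {{?vs ! i, ?vs ! (Suc i mod length ?vs)} |i. i < length ?vs}" ..
  moreover have "edges_within ?E {a, b, c, d} = ?E" by (rule edges_within_superset) auto
  ultimately have "edges_within ?E {a, b, c, d} = {{?vs ! i, ?vs ! (Suc i mod length ?vs)} |i. i < length ?vs}"
    by (simp only:)
  moreover have "length ?vs \<ge> 3" "set ?vs = {a, b, c, d}" by simp_all
  ultimately have cyc: "is_cycle ?E {a, b, c, d}"
    unfolding is_cycle_def using dist by blast
  have sg: "simple_graph k ?E"
    using abcd dist by (intro simple_graph_insert simple_graph_empty) auto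
  have sub: "e \<subseteq> {a, b, c, d}" if "e \<in> ?E" for e using that by auto
  have sub': "{a, b, c, d} \<subseteq> {..<k}" using abcd by auto
  show "cycles_and_paths k ?E" by (rule cycles_and_paths_single(1)[OF sg sub sub' disjI1[OF cyc]])
  show "{a, b, c, d} \<in> cycles k ?E" by (rule cycles_and_paths_single(2)[OF sg sub sub' disjI1[OF cyc] cyc])
qed

text \<open>For \<open>s > 0\<close> the residue classes modulo \<open>s\<close> become paths.
  Different \<open>s\<close> give disjoint edge sets, so counts of kept edges can be added over
  \<open>s\<close>.\<close>

definition step_graph :: "nat \<Rightarrow> nat \<Rightarrow> nat set set" where
  "step_graph k s = {{i, i + s} |i. i + s < k}"

lemma pair_in_step_graph_iff:
  "{x, y} \<in> step_graph k s \<longleftrightarrow> y = x + s \<and> y < k \<or> x = y + s \<and> x < k"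
  unfolding step_graph_def by (auto simp: doubleton_eq_iff)

text \<open>The residue classes modulo \<open>s\<close> form the partition. Since
  \<open>s \<le> k\<close>, each class contains its own residue \<open>a\<close>, hence is not
  empty, and \<open>a, a + s, a + 2 * s, ...\<close> lists it as a path.\<close>

lemma step_graph_pattern:
  assumes s: "0 < s" "s \<le> k"
  shows "cycles_and_paths k (step_graph k s)" "cycles k (step_graph k s) = {}"
proof -
  let ?E = "step_graph k s"
  define C where "C a = {x. x < k \<and> x mod s = a}" for a
  let ?P = "C ` {..<s}"
  have sg: "simple_graph k ?E" unfolding simple_graph_def
  proof
    fix e assume "e \<in> ?E"
    then obtain i where "e = {i, i + s}" "i + s < k" unfolding step_graph_def by blast
    moreover from this have "i < k" "i \<noteq> i + s" using s by simp_all
    ultimately show "e \<in> {{u, v} |u v. u < k \<and> v < k \<and> u \<noteq> v}" by blast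
  qed
  have "x mod s < s" for x using s by simp
  then have U: "\<Union>?P = {..<k}" unfolding C_def by blast
  have D: "disjoint ?P"
  proof (rule disjointI)
    fix A B assume "A \<in> ?P" "B \<in> ?P" "A \<noteq> B"
    then obtain a b where "A = C a" "B = C b" "a \<noteq> b" by blast
    then show "A \<inter> B = {}" unfolding C_def by auto
  qed
  have sub: "\<exists>D\<in>?P. e \<subseteq> D" if "e \<in> ?E" for e
  proof -
    obtain i where i: "e = {i, i + s}" "i + s < k" using \<open>e \<in> ?E\<close> unfolding step_graph_def by blast
    then have "e \<subseteq> C (i mod s)" unfolding C_def by auto
    moreover have "i mod s < s" using s by simp
    ultimately show ?thesis by blast
  qed
  have path: "is_path ?E D" if "D \<in> ?P" for D
  proof -
    obtain a where a: "a < s" "D = C a" using \<open>D \<in> ?P\<close> by blast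
    \<comment> \<open>The size of the residue class of \<open>a\<close> below \<open>k\<close>; as
      \<open>a < k\<close>, the subtraction does not truncate.\<close>
    define l where "l = Suc ((k - 1 - a) div s)"
    have l: "i < l \<longleftrightarrow> a + i * s < k" for i
    proof -
      have "i < l \<longleftrightarrow> i * s \<le> k - 1 - a" unfolding l_def using s by (simp add: less_Suc_eq_le less_eq_div_iff_mult_less_eq)
      then show ?thesis using a s by linarith
    qed
    let ?vs = "map (\<lambda>i. a + i * s) [0..<l]"
    have D_eq: "D = (\<lambda>i. a + i * s) ` {..<l}"
    proof (intro equalityI subsetI)
      fix x assume "x \<in> D"
      then have x: "x < k" "x mod s = a" unfolding a C_def by auto
      have "x = a + x div s * s" using x(2) mod_div_mult_eq[of x s] by simp
      then show "x \<in> (\<lambda>i. a + i * s) ` {..<l}" using l[of "x div s"] x(1) by (intro image_eqI[of _ _ "x div s"]) simp_all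
    next
      fix x assume "x \<in> (\<lambda>i. a + i * s) ` {..<l}"
      then obtain i where i: "x = a + i * s" "i < l" by blast
      then have "x < k" "x mod s = a" using l[of i] a(1) by simp_all
      then show "x \<in> D" unfolding a(2) C_def by blast
    qed
    have set_vs: "set ?vs = D" unfolding D_eq by (simp add: atLeast0LessThan)
    have "edges_within ?E D = {{?vs ! i, ?vs ! Suc i} |i. Suc i < length ?vs}"
    proof (intro equalityI subsetI)
      fix e assume "e \<in> edges_within ?E D"
      then obtain x where x: "e = {x, x + s}" "x + s < k" "x \<in> D"
        unfolding edges_within_def step_graph_def by auto
      then obtain i where i: "x = a + i * s" unfolding D_eq by blast
      then have xs: "x + s = a + Suc i * s" by simp
      then have il: "Suc i < l" using l[of "Suc i"] x(2) by simp
      then have "?vs ! i = x" "?vs ! Suc i = x + s" using i by simp_all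
      then have "e = {?vs ! i, ?vs ! Suc i}" using x(1) by simp
      moreover have "Suc i < length ?vs" using il by simp
      ultimately show "e \<in> {{?vs ! i, ?vs ! Suc i} |i. Suc i < length ?vs}" by blast
    next
      fix e assume "e \<in> {{?vs ! i, ?vs ! Suc i} |i. Suc i < length ?vs}"
      then obtain i where i: "Suc i < length ?vs" "e = {?vs ! i, ?vs ! Suc i}" by blast
      have e: "e = {a + i * s, a + i * s + s}" using i by (simp add: add_ac)
      have "a + i * s + s < k" using i(1) l[of "Suc i"] by (simp add: add_ac)
      then have "e \<in> ?E" unfolding e step_graph_def by blast
      moreover have "?vs ! i \<in> D" "?vs ! Suc i \<in> D"
        using nth_mem[OF Suc_lessD[OF i(1)]] nth_mem[OF i(1)] unfolding set_vs .
      then have "e \<subseteq> D" unfolding i(2) by blast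
      ultimately show "e \<in> edges_within ?E D" unfolding edges_within_def by simp
    qed
    moreover have "inj_on (\<lambda>i. a + i * s) {0..<l}" using s by (intro inj_onI) simp
    then have "distinct ?vs" by (simp add: distinct_map)
    moreover have "?vs \<noteq> []" unfolding l_def by simp
    ultimately show ?thesis unfolding is_path_def using set_vs by blast
  qed
  have kind: "is_cycle ?E D \<or> is_path ?E D" if "D \<in> ?P" for D using path[OF that] ..
  note * = cycles_and_pathsI[OF sg U D sub kind]
  show "cycles_and_paths k ?E" by (rule *(1))
  have cyc: "cycles k ?E = {D \<in> ?P. is_cycle ?E D}" by (rule *(2))
  show "cycles k ?E = {}" unfolding cyc using path is_path_imp_not_is_cycle by blast
qed

section \<open>Extremal bound for graphs without 4-cycles\<close>

text \<open>The Kovari-Sos-Turan argument: two distinct vertices have at most one common neighbour,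
  so the ordered pairs of distinct neighbours, summed over all vertices, number at most
  \<open>k ^ 2\<close>. The choice of \<open>t\<close> as the square root of \<open>k\<close> makes
  the linearization error \<open>t ^ 2\<close> sum to \<open>k ^ 2\<close> as well. \<open>K\<close>
  contains each edge in both directions.\<close>

lemma card_four_cycle_free:
  fixes K :: "(nat \<times> nat) set" and t :: nat
  assumes K: "K \<subseteq> {..<k} \<times> {..<k}" "sym K" "irrefl K"
    and free: "\<And>a b c d. distinct [a, b, c, d] \<Longrightarrow>
      \<not> ((a, b) \<in> K \<and> (b, c) \<in> K \<and> (c, d) \<in> K \<and> (d, a) \<in> K)"
    and k: "k = t * t"
  shows "(2 * real t - 1) * real (card K) \<le> 2 * real k ^ 2"
proof -
  define N where "N x = {y. (x, y) \<in> K}" for x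
  define P where "P x = N x \<times> N x - (\<lambda>y. (y, y)) ` N x" for x
  have N_sub: "N x \<subseteq> {..<k}" for x unfolding N_def using K(1) by auto
  then have fin: "finite (N x)" for x by (rule finite_subset) simp
  have K_eq: "K = (SIGMA x:{..<k}. N x)" unfolding N_def using K(1) by auto
  have cardK: "card K = (\<Sum>x<k. card (N x))" unfolding K_eq using fin by simp
  have cardP: "real (card (P x)) = real (card (N x)) ^ 2 - real (card (N x))" for x
  proof -
    have "card (P x) = card (N x \<times> N x) - card ((\<lambda>y. (y, y)) ` N x)"
      unfolding P_def using fin by (intro card_Diff_subset) auto
    also have "card ((\<lambda>y. (y, y)) ` N x) = card (N x)" by (intro card_image inj_onI) simp
    finally show ?thesis
      by (simp add: card_cartesian_product power2_eq_square of_nat_diff)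
  qed
  have "(\<Sum>x<k. card (P x)) = card (SIGMA x:{..<k}. P x)"
    using fin by (simp add: P_def)
  also have "\<dots> \<le> card ({..<k} \<times> {..<k})"
  proof (rule card_inj_on_le)
    \<comment> \<open>If both \<open>a\<close> and \<open>c\<close> had the neighbours
      \<open>b\<close> and \<open>d\<close>, then \<open>a, b, c, d\<close> would be a 4-cycle; so a
      pair determines its centre.\<close>
    show "inj_on snd (SIGMA x:{..<k}. P x)"
    proof (rule inj_onI, rule ccontr)
      fix p q assume pq: "p \<in> (SIGMA x:{..<k}. P x)" "q \<in> (SIGMA x:{..<k}. P x)" "snd p = snd q" "p \<noteq> q"
      obtain a b d where p: "p = (a, b, d)" by (metis prod_cases3)
      obtain c where q: "q = (c, b, d)" using pq(3) p by (metis prod.collapse snd_conv)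
      have "a \<noteq> c" "b \<noteq> d" "(a, b) \<in> K" "(a, d) \<in> K" "(c, b) \<in> K" "(c, d) \<in> K"
        using pq unfolding p q P_def N_def by auto
      moreover from this have "(b, c) \<in> K" "(d, a) \<in> K" using K(2) by (auto dest: symD)
      moreover from calculation have "distinct [a, b, c, d]" using K(3) unfolding irrefl_def by auto
      ultimately show False using free by blast
    qed
    show "snd ` (SIGMA x:{..<k}. P x) \<subseteq> {..<k} \<times> {..<k}" using N_sub unfolding P_def by fastforce
  qed simp
  finally have "(\<Sum>x<k. card (P x)) \<le> k ^ 2" by (simp add: power2_eq_square)
  then have sumP: "(\<Sum>x<k. real (card (P x))) \<le> real k ^ 2"
    unfolding of_nat_sum[symmetric] of_nat_power[symmetric] of_nat_le_iff .
  \<comment> \<open>\<open>(d - t)\<^sup>2 \<ge> 0\<close> for the degree \<open>d\<close> of \<open>x\<close>, linearizing \<open>d\<^sup>2 - d\<close>\<close>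
  have "(2 * real t - 1) * real (card (N x)) - real k \<le> real (card (P x))" for x
    using zero_le_power2[of "real (card (N x)) - real t"]
    unfolding cardP k by (simp add: power2_eq_square algebra_simps)
  then have "(\<Sum>x<k. (2 * real t - 1) * real (card (N x)) - real k) \<le> (\<Sum>x<k. real (card (P x)))"
    by (intro sum_mono)
  then have "(2 * real t - 1) * real (card K) - real k * real k \<le> real k ^ 2"
    using sumP by (simp add: cardK sum_subtractf sum_distrib_left)
  then show ?thesis by (simp add: power2_eq_square)
qed

text \<open>
  Without communication, agreement makes the answer for an edge independent of the other edges at
  its ends: in the path \<open>z, x, y\<close> the answer of \<open>x\<close> is that of \<open>y\<close>, which knows \<open>x\<close> only. So the set of
  edges that an algorithm keeps on a block is the same in all patterns.
\<close>

definition zero_round_cut :: "local_algorithm \<Rightarrow> tape \<Rightarrow> nat \<Rightarrow> nat \<Rightarrow> nat \<Rightarrow> bool" where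
  "zero_round_cut A \<omega> m x y \<longleftrightarrow> alg_output A \<omega> (alg_init A \<omega> (m + x) {m + y}) (m + y)"

section \<open>Outputs without communication\<close>

lemma zero_round_removes:
  assumes "simple_graph k E" "j < n div k" "x < k"
  shows "removes A (copies n k E) \<omega> 0 (j * k + x) v
    \<longleftrightarrow> alg_output A \<omega> (alg_init A \<omega> (j * k + x) ((+) (j * k) ` neighbours E x)) v"
  unfolding removes_def using neighbours_copies[OF assms] by simp

text \<open>Agreement on the input whose copies consist of the single edge between \<open>x\<close>
  and \<open>y\<close>, where each end sees exactly the other.\<close>

lemma zero_round_cut_sym:
  assumes run: "\<And>E. cycles_and_paths k E \<Longrightarrow> successful_run \<epsilon> n 0 A (copies n k E) \<omega>"
    and j: "j < n div k" and xy: "x < k" "y < k" "x \<noteq> y"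
  shows "zero_round_cut A \<omega> (j * k) x y \<longleftrightarrow> zero_round_cut A \<omega> (j * k) y x"
proof -
  let ?E = "{{x, y}}"
  have sE: "simple_graph k ?E" using edge_pattern[OF xy] unfolding cycles_and_paths_def by simp
  have "neighbours ?E x = {y}" "neighbours ?E y = {x}"
    unfolding neighbours_def using xy(3) by (auto simp: doubleton_eq_iff)
  then show ?thesis
    using agree_in_copy[OF run[OF edge_pattern[OF xy]] sE j, of x y]
      zero_round_removes[OF sE j xy(1), of A \<omega>] zero_round_removes[OF sE j xy(2), of A \<omega>]
    unfolding zero_round_cut_def by simp
qed

text \<open>Here \<open>z\<close> stands for the other neighbour of \<open>x\<close>; if
  \<open>x\<close> has none, any vertex of the pattern except \<open>x\<close> may serve.\<close>

lemma removes_eq_zero_round_cut: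
  assumes run: "\<And>E. cycles_and_paths k E \<Longrightarrow> successful_run \<epsilon> n 0 A (copies n k E) \<omega>"
    and j: "j < n div k" and E: "simple_graph k E" and xy: "{x, y} \<in> E"
    and z: "neighbours E x \<subseteq> {y, z}" "z < k" "z \<noteq> x"
  shows "removes A (copies n k E) \<omega> 0 (j * k + x) (j * k + y) \<longleftrightarrow> zero_round_cut A \<omega> (j * k) x y"
proof -
  have lt: "x < k" "y < k" "x \<noteq> y" using simple_graphD[OF E xy] by auto
  have "y \<in> neighbours E x" unfolding neighbours_def using xy by simp
  then consider "neighbours E x = {y}" | "neighbours E x = {y, z}" "y \<noteq> z" using z(1) by blast
  then show ?thesis
  proof cases
    case 1
    then show ?thesis unfolding zero_round_removes[OF E j lt(1)] zero_round_cut_def by simp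
  next
    case 2
    let ?Q = "{{x, y}, {x, z}}"
    have pat: "cycles_and_paths k ?Q" using lt z 2(2) by (intro two_edge_pattern) auto
    then have sQ: "simple_graph k ?Q" unfolding cycles_and_paths_def by simp
    have nb: "neighbours ?Q x = {y, z}" "neighbours ?Q y = {x}"
      unfolding neighbours_def using lt z 2(2) by (auto simp: doubleton_eq_iff)
    have "removes A (copies n k E) \<omega> 0 (j * k + x) (j * k + y)
        \<longleftrightarrow> removes A (copies n k ?Q) \<omega> 0 (j * k + x) (j * k + y)"
      unfolding zero_round_removes[OF E j lt(1)] zero_round_removes[OF sQ j lt(1)] 2(1) nb(1) ..
    also have "\<dots> \<longleftrightarrow> removes A (copies n k ?Q) \<omega> 0 (j * k + y) (j * k + x)"
      by (rule agree_in_copy[OF run[OF pat] sQ j]) simp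
    also have "\<dots> \<longleftrightarrow> zero_round_cut A \<omega> (j * k) y x"
      unfolding zero_round_removes[OF sQ j lt(2)] nb(2) zero_round_cut_def by simp
    also have "\<dots> \<longleftrightarrow> zero_round_cut A \<omega> (j * k) x y"
      using zero_round_cut_sym[OF run j lt] by simp
    finally show ?thesis .
  qed
qed

text \<open>Some edge of each copy of the 4-cycle is removed, and by the previous lemma this cut
  does not depend on the pattern. The eight cases are the four edges with either end as the removing
  one.\<close>

lemma zero_round_four_cycle:
  assumes run: "\<And>E. cycles_and_paths k E \<Longrightarrow> successful_run \<epsilon> n 0 A (copies n k E) \<omega>"
    and j: "j < n div k" and lt: "a < k" "b < k" "c < k" "d < k" and dist: "distinct [a, b, c, d]"
  shows "zero_round_cut A \<omega> (j * k) a b \<or> zero_round_cut A \<omega> (j * k) b c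
    \<or> zero_round_cut A \<omega> (j * k) c d \<or> zero_round_cut A \<omega> (j * k) d a"
proof -
  let ?E = "{{a, b}, {b, c}, {c, d}, {d, a}}"
  note pat = four_cycle_pattern[OF lt dist]
  have sE: "simple_graph k ?E" using pat unfolding cycles_and_paths_def by simp
  obtain x y where xy: "{x, y} \<in> ?E" "removes A (copies n k ?E) \<omega> 0 (j * k + x) (j * k + y)"
    using cycle_cut_in_copy[OF run[OF pat(1)] pat j] .
  note removed = removes_eq_zero_round_cut[OF run j sE xy(1), THEN iffD1, OF _ _ _ _ xy(2)]
  note sym = zero_round_cut_sym[OF run j]
  have nb: "neighbours ?E a = {b, d}" "neighbours ?E b = {a, c}" "neighbours ?E c = {b, d}" "neighbours ?E d = {a, c}"
    unfolding neighbours_def using dist by (auto simp: doubleton_eq_iff)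
  consider "x = a" "y = b" | "x = b" "y = a" | "x = b" "y = c" | "x = c" "y = b"
    | "x = c" "y = d" | "x = d" "y = c" | "x = d" "y = a" | "x = a" "y = d"
    using xy(1) by (auto simp: doubleton_eq_iff)
  then show ?thesis
  proof cases
    case 1 then show ?thesis using removed[of d] nb lt dist by auto
  next
    case 2 then show ?thesis using removed[of c] nb lt dist sym[of a b] by auto
  next
    case 3 then show ?thesis using removed[of a] nb lt dist by auto
  next
    case 4 then show ?thesis using removed[of d] nb lt dist sym[of b c] by auto
  next
    case 5 then show ?thesis using removed[of b] nb lt dist by auto
  next
    case 6 then show ?thesis using removed[of a] nb lt dist sym[of c d] by auto
  next
    case 7 then show ?thesis using removed[of c] nb lt dist by auto
  next
    case 8 then show ?thesis using removed[of b] nb lt dist sym[of d a] by auto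
  qed
qed

lemma few_zero_round_cuts:
  assumes run: "\<And>E. cycles_and_paths k E \<Longrightarrow> successful_run \<epsilon> n 0 A (copies n k E) \<omega>"
    and s: "0 < s" "s \<le> k"
  shows "real (\<Sum>j<n div k. card {x. x + s < k \<and> zero_round_cut A \<omega> (j * k) x (x + s)}) \<le> \<epsilon> * real n"
proof -
  let ?E = "step_graph k s"
  note pat = step_graph_pattern[OF s]
  have sE: "simple_graph k ?E" using pat unfolding cycles_and_paths_def by simp
  let ?D = "\<lambda>j. {(x, y). x < y \<and> {x, y} \<in> ?E \<and> removes A (copies n k ?E) \<omega> 0 (j * k + x) (j * k + y)}"
  have "card {x. x + s < k \<and> zero_round_cut A \<omega> (j * k) x (x + s)} \<le> card (?D j)" if j: "j < n div k" for j
  proof (rule card_inj_on_le)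
    show "(\<lambda>x. (x, x + s)) ` {x. x + s < k \<and> zero_round_cut A \<omega> (j * k) x (x + s)} \<subseteq> ?D j"
    proof
      fix p assume "p \<in> (\<lambda>x. (x, x + s)) ` {x. x + s < k \<and> zero_round_cut A \<omega> (j * k) x (x + s)}"
      then obtain x where x: "p = (x, x + s)" "x + s < k" "zero_round_cut A \<omega> (j * k) x (x + s)" by blast
      have e: "{x, x + s} \<in> ?E" unfolding pair_in_step_graph_iff using x(2) by simp
      \<comment> \<open>The other neighbour of \<open>x\<close> on its step path is
        \<open>x - s\<close>. If \<open>x\<close> is the first vertex of the path,
        \<open>x + s\<close> is a harmless default.\<close>
      define z where "z = (if s \<le> x then x - s else x + s)"
      have z: "neighbours ?E x \<subseteq> {x + s, z}" "z < k" "z \<noteq> x"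
        unfolding neighbours_def pair_in_step_graph_iff z_def using x(2) s by auto
      show "p \<in> ?D j"
        using removes_eq_zero_round_cut[OF run j sE e z] x e s by simp
    qed
    show "finite (?D j)"
      by (rule finite_subset[of _ "{..<k} \<times> {..<k}"]) (use simple_graphD[OF sE] in auto)
  qed (simp add: inj_on_def)
  then have "(\<Sum>j<n div k. card {x. x + s < k \<and> zero_round_cut A \<omega> (j * k) x (x + s)})
      \<le> (\<Sum>j<n div k. card (?D j))" by (intro sum_mono) simp
  then have "real (\<Sum>j<n div k. card {x. x + s < k \<and> zero_round_cut A \<omega> (j * k) x (x + s)})
      \<le> real (\<Sum>j<n div k. card (?D j))" by (simp only: of_nat_le_iff)
  also have "\<dots> \<le> \<epsilon> * real n"
    using s by (intro few_cuts_in_copies[OF run[OF pat(1)] pat]) simp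
  finally show ?thesis .
qed

section \<open>Counting cuts over all step lengths\<close>

text \<open>The steps up to \<open>u ^ 3\<close> provide at least \<open>u ^ 7 - u ^ 6\<close> pairs
  in a block, and 4-cycle-freeness lets at most \<open>2 * u ^ 6\<close> of them be kept. The range
  \<open>u ^ 3\<close> lies between the square root \<open>u ^ 2\<close> of \<open>k\<close>, which
  it must exceed by far for kept pairs to be negligible, and \<open>k = u ^ 4\<close>, below which
  it must stay for a step graph to have almost \<open>k\<close> edges.\<close>

lemma many_zero_round_cuts:
  assumes run: "\<And>E. cycles_and_paths k E \<Longrightarrow> successful_run \<epsilon> n 0 A (copies n k E) \<omega>"
    and j: "j < n div k" and k: "k = u ^ 4" and u: "u > 0"
  shows "real u ^ 7 - 3 * real u ^ 6
    \<le> real (\<Sum>s\<in>{1..u ^ 3}. card {x. x + s < k \<and> zero_round_cut A \<omega> (j * k) x (x + s)})"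
proof -
  let ?cut = "zero_round_cut A \<omega> (j * k)"
  define K where "K = {(x, y). x < k \<and> y < k \<and> x \<noteq> y \<and> \<not> ?cut x y}"
  define kept where "kept s = {x. x + s < k \<and> \<not> ?cut x (x + s)}" for s
  define cut where "cut s = {x. x + s < k \<and> ?cut x (x + s)}" for s
  have K_sub: "K \<subseteq> {..<k} \<times> {..<k}" unfolding K_def by auto
  then have finK: "finite K" by (rule finite_subset) simp
  have fin: "finite (kept s)" "finite (cut s)" for s
    unfolding kept_def cut_def by (rule finite_subset[of _ "{..<k}"]; auto)+
  have "(2 * real (u ^ 2) - 1) * real (card K) \<le> 2 * real k ^ 2"
  proof (rule card_four_cycle_free[OF K_sub])
    show "sym K" unfolding sym_def K_def using zero_round_cut_sym[OF run j] by auto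
    show "irrefl K" unfolding irrefl_def K_def by auto
    show "\<not> ((a, b) \<in> K \<and> (b, c) \<in> K \<and> (c, d) \<in> K \<and> (d, a) \<in> K)" if "distinct [a, b, c, d]" for a b c d
      using zero_round_four_cycle[OF run j _ _ _ _ that] unfolding K_def by blast
    show "k = u ^ 2 * u ^ 2" unfolding k by (simp add: power_add[symmetric])
  qed
  moreover have "real u ^ 2 * real (card K) \<le> (2 * real (u ^ 2) - 1) * real (card K)"
  proof (rule mult_right_mono)
    have "1 \<le> real u ^ 2" using u by (intro one_le_power) simp
    then show "real u ^ 2 \<le> 2 * real (u ^ 2) - 1" by simp
  qed simp
  moreover have "2 * real k ^ 2 = real u ^ 2 * (2 * real u ^ 6)"
    unfolding k by (simp add: power_mult[symmetric] power_add[symmetric])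
  ultimately have "real u ^ 2 * real (card K) \<le> real u ^ 2 * (2 * real u ^ 6)" by linarith
  then have cardK: "real (card K) \<le> 2 * real u ^ 6" using u by simp
  have "(\<Sum>s\<in>{1..u ^ 3}. card (kept s)) = card (SIGMA s:{1..u ^ 3}. kept s)" using fin by simp
  also have "\<dots> \<le> card K"
  proof (rule card_inj_on_le)
    show "inj_on (\<lambda>(s, x). (x, x + s)) (SIGMA s:{1..u ^ 3}. kept s)" by (auto simp: inj_on_def)
    show "(\<lambda>(s, x). (x, x + s)) ` (SIGMA s:{1..u ^ 3}. kept s) \<subseteq> K" unfolding K_def kept_def by auto
  qed (rule finK)
  finally have "real (\<Sum>s\<in>{1..u ^ 3}. card (kept s)) \<le> real (card K)" by (simp only: of_nat_le_iff)
  then have keptK: "(\<Sum>s\<in>{1..u ^ 3}. real (card (kept s))) \<le> 2 * real u ^ 6" using cardK by simp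
  have "real u ^ 4 - real u ^ 3 \<le> real (card (cut s)) + real (card (kept s))" if "s \<in> {1..u ^ 3}" for s
  proof -
    have "card (cut s) + card (kept s) = card (cut s \<union> kept s)"
      using fin by (intro card_Un_disjoint[symmetric]) (auto simp: cut_def kept_def)
    also have "cut s \<union> kept s = {..<k - s}" unfolding cut_def kept_def by auto
    finally have "card (cut s) + card (kept s) = k - s" by simp
    then have "real k \<le> real (card (cut s) + card (kept s) + s)" by (simp only: of_nat_le_iff)
    moreover have "real s \<le> real (u ^ 3)" using that by (simp only: of_nat_le_iff atLeastAtMost_iff)
    ultimately show ?thesis unfolding k of_nat_add of_nat_power by linarith
  qed
  then have "(\<Sum>s\<in>{1..u ^ 3}. real u ^ 4 - real u ^ 3)
      \<le> (\<Sum>s\<in>{1..u ^ 3}. real (card (cut s)) + real (card (kept s)))" by (rule sum_mono)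
  then have "real u ^ 3 * (real u ^ 4 - real u ^ 3) \<le> (\<Sum>s\<in>{1..u ^ 3}. real (card (cut s))) + 2 * real u ^ 6"
    using keptK by (simp add: sum.distrib)
  moreover have "real u ^ 3 * (real u ^ 4 - real u ^ 3) = real u ^ 7 - real u ^ 6"
    by (simp add: right_diff_distrib power_add[symmetric])
  ultimately have "real u ^ 7 - 3 * real u ^ 6 \<le> (\<Sum>s\<in>{1..u ^ 3}. real (card (cut s)))" by linarith
  then show ?thesis unfolding cut_def by simp
qed

text \<open>The bound depends on \<open>k\<close> alone, so for large \<open>n\<close> all patterns
  can be used as inputs for one common tape.\<close>

lemma finite_patterns: "finite {E. cycles_and_paths k E}" "card {E. cycles_and_paths k E} \<le> 2 ^ 2 ^ k"
proof -
  have sub: "{E. cycles_and_paths k E} \<subseteq> Pow (Pow {..<k})"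
    unfolding cycles_and_paths_def simple_graph_def by blast
  then show "finite {E. cycles_and_paths k E}" by (rule finite_subset) simp
  show "card {E. cycles_and_paths k E} \<le> 2 ^ 2 ^ k"
    using card_mono[OF _ sub] by (simp add: card_Pow)
qed

text \<open>Double counting of cuts over blocks and step lengths: at least
  \<open>u ^ 7 - 3 * u ^ 6\<close> per block, at most \<open>\<epsilon> * n\<close> for each of
  \<open>u ^ 3\<close> step lengths. Inserting \<open>n \<le> u ^ 4 * (n div k + 1)\<close> and
  dividing by \<open>u ^ 6\<close> gives the claim.\<close>

lemma zero_rounds_insufficient:
  assumes sol: "solves_whp \<epsilon> n 0 A" and u: "u > 0" and k: "k = u ^ 4" and n: "n > 2 ^ 2 ^ k"
    and e: "\<epsilon> > 0"
  shows "real (n div k) * (real u - 3) \<le> real u * (\<epsilon> * (real (n div k) + 1))"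
proof -
  let ?F = "copies n k ` {E. cycles_and_paths k E}"
  have k0: "k > 0" using u k by simp
  have "card ?F \<le> card {E. cycles_and_paths k E}" by (rule card_image_le[OF finite_patterns(1)])
  then have "card ?F < n" using n finite_patterns(2)[of k] by linarith
  moreover have "finite ?F" using finite_patterns(1) by simp
  moreover have "cycles_and_paths n E" if "E \<in> ?F" for E using that copies_cycles_and_paths(1)[OF k0] by blast
  ultimately obtain \<omega> where "\<And>E. E \<in> ?F \<Longrightarrow> successful_run \<epsilon> n 0 A E \<omega>"
    using simultaneous_success[OF sol, of ?F] by blast
  then have run: "\<And>E. cycles_and_paths k E \<Longrightarrow> successful_run \<epsilon> n 0 A (copies n k E) \<omega>" by blast
  define c where "c s j = card {x. x + s < k \<and> zero_round_cut A \<omega> (j * k) x (x + s)}" for s j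
  have "real (n div k) * (real u ^ 7 - 3 * real u ^ 6) = (\<Sum>j<n div k. real u ^ 7 - 3 * real u ^ 6)" by simp
  also have "\<dots> \<le> (\<Sum>j<n div k. real (\<Sum>s\<in>{1..u ^ 3}. c s j))"
    unfolding c_def by (rule sum_mono, rule many_zero_round_cuts[OF run _ k u]) simp_all
  also have "\<dots> = (\<Sum>s\<in>{1..u ^ 3}. real (\<Sum>j<n div k. c s j))"
    by (simp only: of_nat_sum) (rule sum.swap)
  also have "\<dots> \<le> (\<Sum>s\<in>{1..u ^ 3}. \<epsilon> * real n)"
  proof (rule sum_mono)
    fix s assume s: "s \<in> {1..u ^ 3}"
    have "u ^ 3 \<le> k" unfolding k using u by (intro power_increasing) auto
    then show "real (\<Sum>j<n div k. c s j) \<le> \<epsilon> * real n"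
      unfolding c_def using s by (intro few_zero_round_cuts run) auto
  qed
  also have "\<dots> = real u ^ 3 * (\<epsilon> * real n)" by simp
  also have "\<dots> \<le> real u ^ 3 * (\<epsilon> * (real u ^ 4 * (real (n div k) + 1)))"
  proof -
    have "n < k * (n div k + 1)" using dividend_less_times_div[OF k0, of n] by simp
    then have "real n \<le> real (k * (n div k + 1))" by (simp only: of_nat_le_iff less_imp_le)
    then have "real n \<le> real u ^ 4 * (real (n div k) + 1)" unfolding k by (simp add: algebra_simps)
    then show ?thesis using e by (intro mult_left_mono) auto
  qed
  finally have "real u ^ 6 * (real (n div k) * (real u - 3)) \<le> real u ^ 6 * (real u * (\<epsilon> * (real (n div k) + 1)))"
    by (simp add: algebra_simps power_numeral_reduce)
  then show ?thesis using u by simp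
qed

lemma at_least_one_round:
  assumes e: "0 < \<epsilon>" "\<epsilon> < 1"
  shows "\<exists>N. \<forall>n\<ge>N. \<forall>A. \<not> solves_whp \<epsilon> n 0 A"
proof -
  \<comment> \<open>The choice of \<open>u\<close> makes the loss 3 at most half of
    \<open>u * (1 - \<epsilon>)\<close>. The choice of \<open>q\<close> then makes the surplus of
    cuts over \<open>q\<close> or more blocks at least \<open>u\<close>, while the incomplete block
    accounts for only \<open>u * \<epsilon>\<close>.\<close>
  define u where "u = nat \<lceil>6 / (1 - \<epsilon>)\<rceil>"
  define k where "k = u ^ 4"
  define q where "q = nat \<lceil>2 / (1 - \<epsilon>)\<rceil>"
  have "real u \<ge> 6 / (1 - \<epsilon>)" unfolding u_def by linarith
  then have u6: "real u * (1 - \<epsilon>) \<ge> 6" using e by (simp add: field_simps)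
  have u: "u > 0" using u6 by (cases u) auto
  have "real q \<ge> 2 / (1 - \<epsilon>)" unfolding q_def by linarith
  then have q: "real q * (1 - \<epsilon>) \<ge> 2" using e by (simp add: field_simps)
  \<comment> \<open>The summand \<open>2 ^ 2 ^ k + 1\<close> serves the union bound over all
    patterns, and \<open>k * q\<close> ensures \<open>q\<close> blocks.\<close>
  have "\<not> solves_whp \<epsilon> n 0 A" if n: "n \<ge> 2 ^ 2 ^ k + 1 + k * q" for n A
  proof
    assume "solves_whp \<epsilon> n 0 A"
    then have le: "real (n div k) * (real u - 3) \<le> real u * (\<epsilon> * (real (n div k) + 1))"
      using n by (intro zero_rounds_insufficient u k_def e) auto
    have "q * k \<le> n" using n by (simp add: mult.commute)
    then have "q \<le> n div k" using u k_def by (simp add: less_eq_div_iff_mult_less_eq)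
    then have "real q * (1 - \<epsilon>) \<le> real (n div k) * (1 - \<epsilon>)" using e by (intro mult_right_mono) auto
    then have big: "2 \<le> real (n div k) * (1 - \<epsilon>)" using q by linarith
    have "real (n div k) * (real u * (1 - \<epsilon>) / 2) \<le> real (n div k) * (real u * (1 - \<epsilon>) - 3)"
      using u6 by (intro mult_left_mono) auto
    also have "\<dots> = real (n div k) * (real u - 3) - real u * (\<epsilon> * real (n div k))" by (simp add: algebra_simps)
    also have "\<dots> \<le> real u * \<epsilon>" using le by (simp add: algebra_simps)
    also have "\<dots> < real u * 1" using u e by (intro mult_strict_left_mono) auto
    finally have "real u * (real (n div k) * (1 - \<epsilon>) / 2) < real u * 1" by (simp add: algebra_simps)
    then show False using big u by simp
  qed
  then show ?thesis by blast
qed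

theorem theorem3:
  shows "\<exists>(C::real) (N::real \<Rightarrow> nat).
    C > 0 \<and>
    (\<lambda>\<epsilon>. real (N \<epsilon>)) \<in> O[at_right 0](\<lambda>\<epsilon>. 1 / \<epsilon>) \<and>
    (\<forall>(\<epsilon>::real) (n::nat) (T::nat) (A::local_algorithm).
       0 < \<epsilon> \<longrightarrow> \<epsilon> < 1 \<longrightarrow> n \<ge> N \<epsilon> \<longrightarrow> solves_whp \<epsilon> n T A \<longrightarrow> real T \<ge> C / \<epsilon>)"
proof -
  obtain M where M: "\<And>\<epsilon> n A. 0 < \<epsilon> \<Longrightarrow> \<epsilon> < 1 \<Longrightarrow> n \<ge> M \<epsilon> \<Longrightarrow> \<not> solves_whp \<epsilon> n 0 A"
    using at_least_one_round by metis
  \<comment> \<open>The threshold \<open>M\<close> comes with no growth bound, but it is used only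
    for \<open>\<epsilon> \<ge> 1 / 32\<close>, so it does not affect the behaviour near 0.\<close>
  define N where "N \<epsilon> = (if \<epsilon> < 1 / 32 then nat \<lceil>1 / (2 * \<epsilon>)\<rceil> else M \<epsilon>)" for \<epsilon> :: real
  have "(\<lambda>\<epsilon>. real (N \<epsilon>)) \<in> O[at_right 0](\<lambda>\<epsilon>. 1 / \<epsilon>)"
  proof (rule bigoI[where c = 1])
    have "norm (real (N \<epsilon>)) \<le> 1 * norm (1 / \<epsilon>)" if "0 < \<epsilon>" "\<epsilon> < 1 / 32" for \<epsilon>
    proof -
      have "real (N \<epsilon>) \<le> 1 / (2 * \<epsilon>) + 1" unfolding N_def using that by simp
      also have "\<dots> \<le> 1 / \<epsilon>" using that by (simp add: field_simps)
      finally show ?thesis using that by simp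
    qed
    then show "\<forall>\<^sub>F \<epsilon> in at_right 0. norm (real (N \<epsilon>)) \<le> 1 * norm (1 / \<epsilon>)"
      unfolding eventually_at_right_field by (intro exI[of _ "1 / 32"]) auto
  qed
  moreover have "real T \<ge> (1 / 32) / \<epsilon>"
    if e: "0 < \<epsilon>" "\<epsilon> < 1" and n: "n \<ge> N \<epsilon>" and sol: "solves_whp \<epsilon> n T A" for \<epsilon> n T A
  proof (cases "\<epsilon> < 1 / 32")
    case True
    then have "real n \<ge> 1 / (2 * \<epsilon>)" using n unfolding N_def by simp
    then show ?thesis by (rule many_rounds_small_epsilon[OF sol e(1) True])
  next
    case False
    then have "n \<ge> M \<epsilon>" using n unfolding N_def by simp
    then have "T \<noteq> 0" using M[OF e] sol by metis
    then have "real T \<ge> 1" by simp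
    \<comment> \<open>For these \<open>\<epsilon>\<close> the claimed bound is at most 1, so
      excluding \<open>T = 0\<close> suffices.\<close>
    moreover have "(1 / 32) / \<epsilon> \<le> 1" using False e by (simp add: field_simps)
    ultimately show ?thesis by linarith
  qed
  ultimately show ?thesis by (intro exI[of _ "1 / 32"] exI[of _ N] conjI allI impI) auto
qed

end
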